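(* Let $D$ be a fat disk-polygon (with some parameter $r>0$) in the Euclidean plane $\mathbb{E}^2$. Then there exists $\varepsilon_0>0$ (depending on $D$) such that for all $0<\varepsilon<\varepsilon_0$, any shortest generalized billiard trajectory of the $\varepsilon$-rounded disk-polygon $D(\varepsilon)$ (i.e. any generalized billiard trajectory of minimal length among all generalized billiard trajectories of $D(\varepsilon)$, of all periods) is $2$-periodic.
   Context: A disk-polygon with parameter $r>0$ is the intersection of finitely many closed circular disks of radius $r$ in $\mathbb{E}^2$ (called its generating disks) having some interior point in common. It is assumed that all generating disks are needed, i.e. each of them contributes a circular arc to the boundary of the disk-polygon. A fat disk-polygon with parameter $r>0$ is a disk-polygon with parameter $r$ such that the pairwise distances between the centers of its generating disks are at most $r$. For a disk-polygon $D$ and a positive $\varepsilon$ not larger than the inradius of $D$ (the radius of the largest circular disk contained in $D$), the $\varepsilon$-rounded disk-polygon $D(\varepsilon)$ is the union of all closed circular disks of radius $\varepsilon$ that lie in $D$. A closed polygonal path (possibly with self-intersections) is given by a cyclic sequence of vertices $p_1,\dots,p_n$, $n\ge 2$, whose sides are the segments $p_ip_{i+1}$ (indices mod $n$); consecutive vertices are distinct, and the vertices are genuine, i.e. consecutive sides at a vertex do not form an angle equal to $\pi$. For $n=2$ the path is a doubly covered line segment. The length of the path is the sum of the lengths of its $n$ sides. The inner angle bisector at $p_i$ is the halfline starting at $p_i$ that bisects the angle formed by the two sides $p_ip_{i-1}$ and $p_ip_{i+1}$ (if the two sides point in the same direction, it is that common direction). For a compact convex set $C\subset\mathbb{E}^2$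 with non-empty interior, a closed polygonal path $P$ is a generalized billiard trajectory of $C$ if all vertices of $P$ lie on the boundary of $C$ and each of the inner angle bisectors of $P$ between two consecutive sides of $P$ is perpendicular to a supporting line of $C$ passing through the corresponding vertex of $P$. If $P$ has $n$ sides it is called $n$-periodic. (For sets without corner points, such as $D(\varepsilon)$, generalized billiard trajectories coincide with billiard trajectories in the traditional sense.) *)

theory Defs
  imports "HOL-Analysis.Analysis"
begin

definition circular_arc :: "real ^ 2 \<Rightarrow> real \<Rightarrow> real \<Rightarrow> real \<Rightarrow> (real ^ 2) set" where
  "circular_arc c r a b = (\<lambda>t. c + r *\<^sub>R vector [cos t, sin t]) ` {a..b}"

text \<open>A disk-polygon \<open>D\<close> with parameter \<open>r\<close>, where \<open>X\<close> is the set of the centers of its generating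
  disks. The last conjunct says that every generating disk is needed: it contributes a
  nondegenerate circular arc to the boundary.\<close>

definition disk_polygon :: "real \<Rightarrow> (real ^ 2) set \<Rightarrow> (real ^ 2) set \<Rightarrow> bool" where
  "disk_polygon r X D \<longleftrightarrow>
     r > 0 \<and> finite X \<and> X \<noteq> {} \<and> D = (\<Inter>c\<in>X. cball c r) \<and> interior D \<noteq> {} \<and>
     (\<forall>c\<in>X. \<exists>a b. a < b \<and> circular_arc c r a b \<subseteq> frontier D)"

definition fat_disk_polygon :: "real \<Rightarrow> (real ^ 2) set \<Rightarrow> bool" where
  "fat_disk_polygon r D \<longleftrightarrow>
     (\<exists>X. disk_polygon r X D \<and> (\<forall>x\<in>X. \<forall>y\<in>X. dist x y \<le> r))"

definition inradius :: "(real ^ 2) set \<Rightarrow> real" where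
  "inradius D = Sup {\<rho>. 0 \<le> \<rho> \<and> (\<exists>x. cball x \<rho> \<subseteq> D)}"

definition rounded :: "(real ^ 2) set \<Rightarrow> real \<Rightarrow> (real ^ 2) set" where
  "rounded D \<epsilon> = \<Union> {cball x \<epsilon> | x. cball x \<epsilon> \<subseteq> D}"

text \<open>The angle in \<open>[0, \<pi>]\<close> between two nonzero vectors.\<close>

definition vec_angle :: "real ^ 2 \<Rightarrow> real ^ 2 \<Rightarrow> real" where
  "vec_angle u v = arccos (inner u v / (norm u * norm v))"

text \<open>A closed polygonal path is represented by the list of its vertices, read cyclically.\<close>

definition next_vertex :: "(real ^ 2) list \<Rightarrow> nat \<Rightarrow> real ^ 2" where
  "next_vertex ps i = ps ! ((i + 1) mod length ps)"

definition prev_vertex :: "(real ^ 2) list \<Rightarrow> nat \<Rightarrow> real ^ 2" where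
  "prev_vertex ps i = ps ! ((i + length ps - 1) mod length ps)"

definition closed_polygonal_path :: "(real ^ 2) list \<Rightarrow> bool" where
  "closed_polygonal_path ps \<longleftrightarrow>
     length ps \<ge> 2 \<and>
     (\<forall>i < length ps. ps ! i \<noteq> next_vertex ps i) \<and>
     (\<forall>i < length ps. vec_angle (prev_vertex ps i - ps ! i) (next_vertex ps i - ps ! i) \<noteq> pi)"

definition path_len :: "(real ^ 2) list \<Rightarrow> real" where
  "path_len ps = (\<Sum>i < length ps. dist (ps ! i) (next_vertex ps i))"

text \<open>The halfline from \<open>p\<close> bisecting the angle formed by the segments \<open>pa\<close> and \<open>pb\<close>. When
  that angle is less than \<open>\<pi>\<close>, the points \<open>x\<close> below form exactly one halfline; when it
  is \<open>0\<close>, this is the halfline in the common direction of the two segments.\<close>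

definition inner_angle_bisector :: "real ^ 2 \<Rightarrow> real ^ 2 \<Rightarrow> real ^ 2 \<Rightarrow> (real ^ 2) set" where
  "inner_angle_bisector a p b =
     {x. x = p \<or>
         (vec_angle (x - p) (a - p) = vec_angle (a - p) (b - p) / 2 \<and>
          vec_angle (x - p) (b - p) = vec_angle (a - p) (b - p) / 2)}"

definition supporting_line :: "(real ^ 2) set \<Rightarrow> (real ^ 2) set \<Rightarrow> bool" where
  "supporting_line C L \<longleftrightarrow>
     (\<exists>a b. a \<noteq> 0 \<and> L = {x. inner a x = b} \<and> L \<inter> C \<noteq> {} \<and> (\<forall>x\<in>C. inner a x \<le> b))"

text \<open>Meant for compact convex \<open>C\<close> with nonempty interior; every \<open>rounded D \<epsilon>\<close>, for \<open>D\<close> a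
  disk-polygon and \<open>\<epsilon>\<close> positive and at most its inradius, is such a set.\<close>

definition generalized_billiard_trajectory :: "(real ^ 2) set \<Rightarrow> (real ^ 2) list \<Rightarrow> bool" where
  "generalized_billiard_trajectory C ps \<longleftrightarrow>
     closed_polygonal_path ps \<and> set ps \<subseteq> frontier C \<and>
     (\<forall>i < length ps. \<exists>L. supporting_line C L \<and> ps ! i \<in> L \<and>
        (\<forall>x \<in> inner_angle_bisector (prev_vertex ps i) (ps ! i) (next_vertex ps i).
           \<forall>y \<in> L. inner (x - ps ! i) (y - ps ! i) = 0))"

definition periodic_trajectory :: "nat \<Rightarrow> (real ^ 2) list \<Rightarrow> bool" where
  "periodic_trajectory n ps \<longleftrightarrow> length ps = n"

definition shortest_generalized_billiard_trajectory :: "(real ^ 2) set \<Rightarrow> (real ^ 2) list \<Rightarrow> bool" where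
  "shortest_generalized_billiard_trajectory C ps \<longleftrightarrow>
     generalized_billiard_trajectory C ps \<and>
     (\<forall>qs. generalized_billiard_trajectory C qs \<longrightarrow> path_len ps \<le> path_len qs)"

end

theory Submission
  imports Defs
begin

text \<open>
  The \<epsilon>-rounded disk-polygon K is the outer parallel body, at distance \<epsilon>, of the intersection E of the
  disks of radius r - \<epsilon> around the centers of the generating disks of D. A chord of K that realizes its
  minimal width w is normal to K at both ends, so it is a 2-periodic trajectory of length 2 w
  (\<open>double_normal\<close>, \<open>double_normal_is_trajectory\<close>). Thus it suffices that every trajectory with at least
  three vertices is longer than 2 w, and this is shown for every \<epsilon> smaller than the inradius of D
  (\<open>long_trajectory\<close>).

  At a vertex of a trajectory the sum of the unit vectors along the two sides is a positive multiple of
  an inner normal of K. Summed over all vertices these vectors cancel, so outer normals at the vertices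
  satisfy a positive linear relation, and two or three of them already contain the origin in their convex
  hull. If two normals are opposite, the two vertices have distance at least w, and the rest of the path
  adds enough to exceed 2 w. Otherwise three vertices lie on the sides of a triangle formed by supporting
  lines of K, and the path is at least as long as the triangle that they span.

  The perimeter of a triangle inscribed in a triangle T is at least that of the orthic triangle if T is
  acute, and at least twice the altitude from the largest angle otherwise (\<open>perimeter_ge_orthic\<close>,
  \<open>perimeter_ge_altitude\<close>). The second case is settled by convexity alone: the altitude exceeds the width
  in its direction, strictly because K has no corners (\<open>Phi_ge_altitude\<close>).

  Fatness is needed for acute T. Half the perimeter of the orthic triangle, as a function of one normal that
  varies over the normal cone of E at a point, is strictly concave. It is therefore enough to compare it
  with w when T is right-angled, which is again the altitude estimate, and when every normal of T is
  a normal of one of the generating circles (\<open>wide_step\<close>, \<open>nonobtuse_wide\<close>). In the latter situation let m be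
  the largest distance between the three centers, so that m \<le> r. Then w is at most 2 r - m, the width of
  the lens of two generating disks of D, and the claim reduces to the inequality 2R + inradius \<le> semiperimeter
  for nonobtuse triangles with circumradius R (\<open>wide_if_arc_normals\<close>, \<open>nonobtuse_sum_sines\<close>).
\<close>

section \<open>Plane trigonometry with inner and cross products\<close>

definition cross2 :: "real ^ 2 \<Rightarrow> real ^ 2 \<Rightarrow> real" where
  "cross2 u v = u $ 1 * v $ 2 - u $ 2 * v $ 1"

definition rot :: "real ^ 2 \<Rightarrow> real ^ 2" where
  "rot u = vector [- (u $ 2), u $ 1]"

lemma inner_vec2: "inner u (v :: real ^ 2) = u $ 1 * v $ 1 + u $ 2 * v $ 2"
  by (simp add: inner_vec_def sum_2)

lemma vec2_eq_iff: "u = v \<longleftrightarrow> u $ 1 = v $ 1 \<and> u $ 2 = (v :: real ^ 2) $ 2"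
  by (simp add: vec_eq_iff forall_2)

lemma rot_nth [simp]: "rot u $ 1 = - (u $ 2)" "rot u $ 2 = u $ 1"
  by (simp_all add: rot_def)

lemmas coords = inner_vec2 vec2_eq_iff cross2_def rot_nth

lemma inner_rot: "inner (rot u) v = cross2 u v"
  by (simp add: coords)

lemma norm_rot [simp]: "norm (rot u) = norm u"
  by (simp add: norm_eq_sqrt_inner inner_vec2)

lemma norm_eq_1_vec2: "norm (u :: real ^ 2) = 1 \<longleftrightarrow> u $ 1 * u $ 1 + u $ 2 * u $ 2 = 1"
  by (simp add: norm_eq_1 inner_vec2)

lemma cross2_skew: "cross2 v u = - cross2 u v"
  by (simp add: cross2_def)

lemma cross2_self [simp]: "cross2 u u = 0"
  by (simp add: cross2_def)

lemma cross2_cyclic: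
  "cross2 u\<^sub>2 u\<^sub>3 *\<^sub>R u\<^sub>1 + cross2 u\<^sub>3 u\<^sub>1 *\<^sub>R u\<^sub>2 + cross2 u\<^sub>1 u\<^sub>2 *\<^sub>R u\<^sub>3 = 0"
  by (simp add: coords algebra_simps)

lemma cross2_inner_Pythagoras:
  assumes "norm u = 1" "norm v = 1"
  shows "(cross2 u v)\<^sup>2 + (inner u v)\<^sup>2 = 1"
proof -
  have "(cross2 u v)\<^sup>2 + (inner u v)\<^sup>2
      = (u $ 1 * u $ 1 + u $ 2 * u $ 2) * (v $ 1 * v $ 1 + v $ 2 * v $ 2)"
    unfolding coords by algebra
  then show ?thesis using assms by (simp add: norm_eq_1_vec2)
qed

lemma inner_decomp:
  assumes "norm a = 1"
  shows "inner u v = inner a u * inner a v + cross2 a u * cross2 a v"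
proof -
  have "inner a u * inner a v + cross2 a u * cross2 a v = (a $ 1 * a $ 1 + a $ 2 * a $ 2) * inner u v"
    unfolding coords by algebra
  then show ?thesis using assms by (simp add: norm_eq_1_vec2)
qed

lemma cross2_decomp:
  assumes "norm a = 1"
  shows "cross2 u v = - cross2 v a * inner a u - cross2 a u * inner v a"
proof -
  have "- cross2 v a * inner a u - cross2 a u * inner v a = (a $ 1 * a $ 1 + a $ 2 * a $ 2) * cross2 u v"
    unfolding coords by algebra
  then show ?thesis using assms by (simp add: norm_eq_1_vec2)
qed

lemma norm_combine_rot:
  assumes "norm u = 1" "a\<^sup>2 + b\<^sup>2 = 1"
  shows "norm (a *\<^sub>R u + b *\<^sub>R rot u) = 1"
proof -
  have "inner (a *\<^sub>R u + b *\<^sub>R rot u) (a *\<^sub>R u + b *\<^sub>R rot u)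
      = (a\<^sup>2 + b\<^sup>2) * (u $ 1 * u $ 1 + u $ 2 * u $ 2)"
    by (simp add: coords) algebra
  then show ?thesis using assms by (simp add: norm_eq_1 norm_eq_1_vec2[symmetric] norm_eq_1_vec2)
qed

lemma inner_le_dist:
  assumes "norm e \<le> 1"
  shows "inner e (p - q) \<le> dist p q"
proof -
  have "inner e (p - q) \<le> norm e * norm (p - q)" by (rule norm_cauchy_schwarz)
  also have "\<dots> \<le> 1 * norm (p - q)" using assms by (intro mult_right_mono) auto
  finally show ?thesis by (simp add: dist_norm)
qed

text \<open>Each point is thought of as lying on the side of the circumscribed triangle with the normal of the same
  index. Each distance is at least the inner product of the difference with any unit vector; for the
  directions of the sides of the orthic triangle, which reflect into each other at the sides of the
  circumscribed triangle, the sum of these inner products depends on the sides alone and not on the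
  position of the points on them. This is the lower-bound half of Fagnano's theorem.\<close>

lemma perimeter_ge_orthic:
  assumes "norm u\<^sub>1 = 1" "norm u\<^sub>2 = 1" "norm u\<^sub>3 = 1"
  shows "2 * (cross2 u\<^sub>2 u\<^sub>3 * inner u\<^sub>1 p\<^sub>1 + cross2 u\<^sub>3 u\<^sub>1 * inner u\<^sub>2 p\<^sub>2 + cross2 u\<^sub>1 u\<^sub>2 * inner u\<^sub>3 p\<^sub>3)
     \<le> dist p\<^sub>1 p\<^sub>2 + dist p\<^sub>2 p\<^sub>3 + dist p\<^sub>3 p\<^sub>1"
proof -
  define s1 s2 s3 where s: "s1 = cross2 u\<^sub>2 u\<^sub>3" "s2 = cross2 u\<^sub>3 u\<^sub>1" "s3 = cross2 u\<^sub>1 u\<^sub>2"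
  define e where "e = s1 *\<^sub>R u\<^sub>1 + inner u\<^sub>2 u\<^sub>3 *\<^sub>R rot u\<^sub>1"
  define f where "f = s2 *\<^sub>R u\<^sub>2 + inner u\<^sub>3 u\<^sub>1 *\<^sub>R rot u\<^sub>2"
  define g where "g = (- s1) *\<^sub>R u\<^sub>1 + inner u\<^sub>2 u\<^sub>3 *\<^sub>R rot u\<^sub>1"
  have n: "norm e = 1" "norm f = 1" "norm g = 1"
    unfolding e_def f_def g_def
    by (rule norm_combine_rot; simp add: s assms cross2_inner_Pythagoras)+
  have fe: "f = e + (2 * s2) *\<^sub>R u\<^sub>2"
    by (simp add: e_def f_def s coords algebra_simps)
  have ge: "g = e - (2 * s1) *\<^sub>R u\<^sub>1"
    by (simp add: e_def g_def s coords algebra_simps)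
  have "inner e (p\<^sub>1 - p\<^sub>2) + inner f (p\<^sub>2 - p\<^sub>3) + inner g (p\<^sub>3 - p\<^sub>1)
      = 2 * (s1 * inner u\<^sub>1 p\<^sub>1 + s2 * inner u\<^sub>2 p\<^sub>2 - inner (s1 *\<^sub>R u\<^sub>1 + s2 *\<^sub>R u\<^sub>2) p\<^sub>3)"
    unfolding fe ge by (simp add: inner_simps algebra_simps)
  also have "s1 *\<^sub>R u\<^sub>1 + s2 *\<^sub>R u\<^sub>2 = - (s3 *\<^sub>R u\<^sub>3)"
    using cross2_cyclic[of u\<^sub>2 u\<^sub>3 u\<^sub>1] by (simp add: s add_eq_0_iff)
  finally have "inner e (p\<^sub>1 - p\<^sub>2) + inner f (p\<^sub>2 - p\<^sub>3) + inner g (p\<^sub>3 - p\<^sub>1)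
      = 2 * (s1 * inner u\<^sub>1 p\<^sub>1 + s2 * inner u\<^sub>2 p\<^sub>2 + s3 * inner u\<^sub>3 p\<^sub>3)" by simp
  moreover have "inner e (p\<^sub>1 - p\<^sub>2) + inner f (p\<^sub>2 - p\<^sub>3) + inner g (p\<^sub>3 - p\<^sub>1)
      \<le> dist p\<^sub>1 p\<^sub>2 + dist p\<^sub>2 p\<^sub>3 + dist p\<^sub>3 p\<^sub>1"
    using n by (intro add_mono inner_le_dist) auto
  ultimately show ?thesis by (simp add: s)
qed

text \<open>If the angle between the second and the third side is not acute, the shortest inscribed path is the doubly covered altitude from that
  vertex. The same duality argument applies: two of the three test directions are now the altitude
  direction \<open>u\<^sub>1\<close>, and the third, forced by the requirement that sliding the points along their
  sides leave the sum unchanged, has norm at most 1 because that angle is not acute.\<close>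

lemma perimeter_ge_altitude:
  assumes n: "norm u\<^sub>1 = 1" "norm u\<^sub>2 = 1" "norm u\<^sub>3 = 1"
    and pos: "cross2 u\<^sub>2 u\<^sub>3 > 0" "cross2 u\<^sub>3 u\<^sub>1 > 0" "cross2 u\<^sub>1 u\<^sub>2 > 0"
    and obt: "inner u\<^sub>2 u\<^sub>3 \<ge> 0"
  shows "2 * (cross2 u\<^sub>2 u\<^sub>3 * inner u\<^sub>1 p\<^sub>1 + cross2 u\<^sub>3 u\<^sub>1 * inner u\<^sub>2 p\<^sub>2 + cross2 u\<^sub>1 u\<^sub>2 * inner u\<^sub>3 p\<^sub>3)
     \<le> cross2 u\<^sub>2 u\<^sub>3 * (dist p\<^sub>1 p\<^sub>2 + dist p\<^sub>2 p\<^sub>3 + dist p\<^sub>3 p\<^sub>1)"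
proof -
  define s1 s2 s3 where s: "s1 = cross2 u\<^sub>2 u\<^sub>3" "s2 = cross2 u\<^sub>3 u\<^sub>1" "s3 = cross2 u\<^sub>1 u\<^sub>2"
  define l where "l = 2 * s2 / s1"
  define e where "e = u\<^sub>1 + l *\<^sub>R u\<^sub>2"
  have l0: "l \<ge> 0" using pos by (simp add: l_def s)
  have "s2 = - s3 * inner u\<^sub>2 u\<^sub>3 - s1 * inner u\<^sub>1 u\<^sub>2"
    unfolding s using cross2_decomp[OF n(2), of u\<^sub>3 u\<^sub>1] by (simp add: inner_commute)
  moreover have "s3 * inner u\<^sub>2 u\<^sub>3 \<ge> 0" using pos obt by (simp add: s)
  ultimately have "s2 \<le> - s1 * inner u\<^sub>1 u\<^sub>2" by linarith
  then have "l \<le> - 2 * inner u\<^sub>1 u\<^sub>2"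
    using pos by (simp add: l_def s field_simps)
  then have "l * (l + 2 * inner u\<^sub>1 u\<^sub>2) \<le> 0"
    using l0 by (simp add: mult_nonneg_nonpos)
  moreover have "(norm e)\<^sup>2 = 1 + l * (l + 2 * inner u\<^sub>1 u\<^sub>2)"
    using n unfolding e_def power2_norm_eq_inner
    by (simp add: inner_simps norm_eq_1 inner_commute algebra_simps)
  ultimately have "(norm e)\<^sup>2 \<le> 1\<^sup>2" by simp
  then have ne: "norm e \<le> 1" by (rule power2_le_imp_le) simp
  have s1e: "s1 *\<^sub>R e = s1 *\<^sub>R u\<^sub>1 + (2 * s2) *\<^sub>R u\<^sub>2"
    using pos by (simp add: e_def l_def s scaleR_add_right)
  have s3u: "s1 *\<^sub>R u\<^sub>1 + s2 *\<^sub>R u\<^sub>2 = - (s3 *\<^sub>R u\<^sub>3)"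
    using cross2_cyclic[of u\<^sub>2 u\<^sub>3 u\<^sub>1] by (simp add: s add_eq_0_iff)
  have "s1 * (inner u\<^sub>1 (p\<^sub>1 - p\<^sub>2) + inner e (p\<^sub>2 - p\<^sub>3) + inner (- u\<^sub>1) (p\<^sub>3 - p\<^sub>1))
     = s1 * inner u\<^sub>1 (p\<^sub>1 - p\<^sub>2) + inner (s1 *\<^sub>R e) (p\<^sub>2 - p\<^sub>3) + s1 * inner (- u\<^sub>1) (p\<^sub>3 - p\<^sub>1)"
    by (simp add: algebra_simps)
  also have "\<dots> = 2 * (s1 * inner u\<^sub>1 p\<^sub>1 + s2 * inner u\<^sub>2 p\<^sub>2 - inner (s1 *\<^sub>R u\<^sub>1 + s2 *\<^sub>R u\<^sub>2) p\<^sub>3)"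
    unfolding s1e by (simp add: inner_simps algebra_simps)
  also have "\<dots> = 2 * (s1 * inner u\<^sub>1 p\<^sub>1 + s2 * inner u\<^sub>2 p\<^sub>2 + s3 * inner u\<^sub>3 p\<^sub>3)"
    unfolding s3u by simp
  finally have "2 * (s1 * inner u\<^sub>1 p\<^sub>1 + s2 * inner u\<^sub>2 p\<^sub>2 + s3 * inner u\<^sub>3 p\<^sub>3)
      = s1 * (inner u\<^sub>1 (p\<^sub>1 - p\<^sub>2) + inner e (p\<^sub>2 - p\<^sub>3) + inner (- u\<^sub>1) (p\<^sub>3 - p\<^sub>1))" by simp
  also have "\<dots> \<le> s1 * (dist p\<^sub>1 p\<^sub>2 + dist p\<^sub>2 p\<^sub>3 + dist p\<^sub>3 p\<^sub>1)"
    using n ne pos by (intro mult_left_mono add_mono inner_le_dist) (auto simp: s)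
  finally show ?thesis by (simp add: s)
qed

text \<open>Three unit vectors, listed counterclockwise, are viewed as the outer normals of a triangle. If its
  angles are A1, A2, A3, then A1 = \<pi> - (angle from u2 to u3), so that
  \<open>cross2 u\<^sub>2 u\<^sub>3\<close> is the sine of A1, \<open>- inner u\<^sub>2 u\<^sub>3\<close> is its cosine, and cyclically. All
  trigonometry of the triangle is done in these two quantities. Degenerate triples with
  A1 = 0, that is u2 = - u3, are included on purpose: they arise as end points when a normal is rotated.\<close>

definition nonobtuse :: "real ^ 2 \<Rightarrow> real ^ 2 \<Rightarrow> real ^ 2 \<Rightarrow> bool" where
  "nonobtuse u\<^sub>1 u\<^sub>2 u\<^sub>3 \<longleftrightarrow>
     norm u\<^sub>1 = 1 \<and> norm u\<^sub>2 = 1 \<and> norm u\<^sub>3 = 1 \<and>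
     cross2 u\<^sub>2 u\<^sub>3 \<ge> 0 \<and> cross2 u\<^sub>3 u\<^sub>1 \<ge> 0 \<and> cross2 u\<^sub>1 u\<^sub>2 \<ge> 0 \<and>
     inner u\<^sub>2 u\<^sub>3 \<le> 0 \<and> inner u\<^sub>3 u\<^sub>1 \<le> 0 \<and> inner u\<^sub>1 u\<^sub>2 \<le> 0"

definition acute :: "real ^ 2 \<Rightarrow> real ^ 2 \<Rightarrow> real ^ 2 \<Rightarrow> bool" where
  "acute u\<^sub>1 u\<^sub>2 u\<^sub>3 \<longleftrightarrow> inner u\<^sub>2 u\<^sub>3 < 0 \<and> inner u\<^sub>3 u\<^sub>1 < 0 \<and> inner u\<^sub>1 u\<^sub>2 < 0"

lemma nonobtuse_rotate: "nonobtuse u\<^sub>1 u\<^sub>2 u\<^sub>3 \<Longrightarrow> nonobtuse u\<^sub>2 u\<^sub>3 u\<^sub>1"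
  by (auto simp: nonobtuse_def)

lemma acute_rotate: "acute u\<^sub>1 u\<^sub>2 u\<^sub>3 \<Longrightarrow> acute u\<^sub>2 u\<^sub>3 u\<^sub>1"
  by (auto simp: acute_def)

text \<open>These are sin A1 = sin (A2 + A3), cos A1 = - cos (A2 + A3) and the Pythagorean identity.\<close>

lemma unit_triple_sines:
  assumes "norm u\<^sub>1 = 1" "norm u\<^sub>2 = 1" "norm u\<^sub>3 = 1"
  shows "cross2 u\<^sub>2 u\<^sub>3 = cross2 u\<^sub>3 u\<^sub>1 * - inner u\<^sub>1 u\<^sub>2 + cross2 u\<^sub>1 u\<^sub>2 * - inner u\<^sub>3 u\<^sub>1"
    and "- inner u\<^sub>2 u\<^sub>3 = cross2 u\<^sub>3 u\<^sub>1 * cross2 u\<^sub>1 u\<^sub>2 - inner u\<^sub>1 u\<^sub>2 * inner u\<^sub>3 u\<^sub>1"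
    and "(cross2 u\<^sub>2 u\<^sub>3)\<^sup>2 + (inner u\<^sub>2 u\<^sub>3)\<^sup>2 = 1"
  using cross2_decomp[of u\<^sub>1 u\<^sub>2 u\<^sub>3] inner_decomp[of u\<^sub>1 u\<^sub>2 u\<^sub>3] cross2_inner_Pythagoras[of u\<^sub>2 u\<^sub>3] assms
  by (simp_all add: inner_commute cross2_skew[of u\<^sub>3 u\<^sub>1] algebra_simps)

text \<open>In terms of semiperimeter s, circumradius R and inradius r of a triangle, \<open>1 + C \<le> S\<close> is the classical
  inequality 2R + r \<le> s for nonobtuse triangles, with equality exactly for right angles. It follows from
  S^2 - (1 + C)^2 = 4 cos A1 cos A2 cos A3.\<close>

lemma nonobtuse_sum_sines:
  assumes "nonobtuse u\<^sub>1 u\<^sub>2 u\<^sub>3"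
  defines "S \<equiv> cross2 u\<^sub>2 u\<^sub>3 + cross2 u\<^sub>3 u\<^sub>1 + cross2 u\<^sub>1 u\<^sub>2"
    and "C \<equiv> - inner u\<^sub>2 u\<^sub>3 - inner u\<^sub>3 u\<^sub>1 - inner u\<^sub>1 u\<^sub>2"
  shows "1 \<le> C" "1 + C \<le> S" "acute u\<^sub>1 u\<^sub>2 u\<^sub>3 \<Longrightarrow> 1 + C < S"
proof -
  define s1 s2 s3 where s: "s1 = cross2 u\<^sub>2 u\<^sub>3" "s2 = cross2 u\<^sub>3 u\<^sub>1" "s3 = cross2 u\<^sub>1 u\<^sub>2"
  define c1 c2 c3 where c: "c1 = - inner u\<^sub>2 u\<^sub>3" "c2 = - inner u\<^sub>3 u\<^sub>1" "c3 = - inner u\<^sub>1 u\<^sub>2"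
  have n: "norm u\<^sub>1 = 1" "norm u\<^sub>2 = 1" "norm u\<^sub>3 = 1" 
    and nn: "0 \<le> s1" "0 \<le> s2" "0 \<le> s3" "0 \<le> c1" "0 \<le> c2" "0 \<le> c3"
    using assms(1) by (simp_all add: nonobtuse_def s c)
  have c': "c1 = s2 * s3 - c2 * c3" "c2 = s3 * s1 - c3 * c1" "c3 = s1 * s2 - c1 * c2"
    using unit_triple_sines(2)[OF n] unit_triple_sines(2)[OF n(2,3,1)] unit_triple_sines(2)[OF n(3,1,2)]
    unfolding s c minus_mult_minus by (simp_all only: mult.commute)
  have sq: "s1\<^sup>2 + c1\<^sup>2 = 1" "s2\<^sup>2 + c2\<^sup>2 = 1" "s3\<^sup>2 + c3\<^sup>2 = 1"
    using unit_triple_sines(3)[OF n] unit_triple_sines(3)[OF n(2,3,1)] unit_triple_sines(3)[OF n(3,1,2)]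
    by (simp_all add: s c)
  have "(c1 + c2 * c3)\<^sup>2 = (1 - c2\<^sup>2) * (1 - c3\<^sup>2)"
  proof -
    have "(c1 + c2 * c3)\<^sup>2 = (s2 * s3)\<^sup>2" using c'(1) by (metis diff_add_cancel)
    also have "\<dots> = s2\<^sup>2 * s3\<^sup>2" by (rule power_mult_distrib)
    also have "s2\<^sup>2 = 1 - c2\<^sup>2" using sq by linarith
    also have "s3\<^sup>2 = 1 - c3\<^sup>2" using sq by linarith
    finally show ?thesis .
  qed
  then have ccc: "c1\<^sup>2 + c2\<^sup>2 + c3\<^sup>2 + 2 * c1 * c2 * c3 = 1"
    by (simp add: power2_eq_square algebra_simps)
  have le1: "c3 \<le> 1"
  proof (rule power2_le_imp_le)
    show "c3\<^sup>2 \<le> 1\<^sup>2" using sq(3) zero_le_power2[of s3] unfolding one_power2 by linarith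
  qed simp
  have "c1 * c2 * c3 \<le> c1 * c2 + c2 * c3 + c3 * c1"
  proof -
    have "c1 * c2 * c3 \<le> c1 * c2 * 1" using le1 nn by (intro mult_left_mono) auto
    then show ?thesis using nn by (smt (verit) mult_nonneg_nonneg)
  qed
  then have "1\<^sup>2 \<le> (c1 + c2 + c3)\<^sup>2"
    using ccc by (simp add: power2_eq_square algebra_simps)
  then have "1 \<le> c1 + c2 + c3" by (rule power2_le_imp_le) (use nn in simp)
  then show "1 \<le> C" by (simp add: C_def c)
  have "(s1 + s2 + s3)\<^sup>2 - (1 + (c1 + c2 + c3))\<^sup>2
      = (s1\<^sup>2 + s2\<^sup>2 + s3\<^sup>2) - 1 - (c1\<^sup>2 + c2\<^sup>2 + c3\<^sup>2)
        + 2 * ((s2 * s3 - c2 * c3 - c1) + (s3 * s1 - c3 * c1 - c2) + (s1 * s2 - c1 * c2 - c3))"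
    by (simp add: power2_eq_square algebra_simps)
  also have "\<dots> = 4 * (c1 * c2 * c3)"
  proof -
    have "s2 * s3 - c2 * c3 - c1 = 0" "s3 * s1 - c3 * c1 - c2 = 0" "s1 * s2 - c1 * c2 - c3 = 0"
      using c' by linarith+
    moreover have "s1\<^sup>2 + s2\<^sup>2 + s3\<^sup>2 = 3 - (c1\<^sup>2 + c2\<^sup>2 + c3\<^sup>2)"
      using sq by linarith
    ultimately show ?thesis using ccc by simp
  qed
  finally have key: "(s1 + s2 + s3)\<^sup>2 = (1 + (c1 + c2 + c3))\<^sup>2 + 4 * (c1 * c2 * c3)" by simp
  have "(1 + (c1 + c2 + c3))\<^sup>2 \<le> (s1 + s2 + s3)\<^sup>2" using key nn by simp
  then have "1 + (c1 + c2 + c3) \<le> s1 + s2 + s3" by (rule power2_le_imp_le) (use nn in simp)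
  then show "1 + C \<le> S" by (simp add: C_def S_def s c)
  assume "acute u\<^sub>1 u\<^sub>2 u\<^sub>3"
  then have "(1 + (c1 + c2 + c3))\<^sup>2 < (s1 + s2 + s3)\<^sup>2" 
  proof -
    have "0 < c1 * c2 * c3" using \<open>acute u\<^sub>1 u\<^sub>2 u\<^sub>3\<close> by (intro mult_pos_pos) (simp_all add: acute_def c)
    then show ?thesis using key by linarith
  qed
  then have "1 + (c1 + c2 + c3) < s1 + s2 + s3" by (rule power2_less_imp_less) (use nn in simp)
  then show "1 + C < S" by (simp add: C_def S_def s c)
qed

text \<open>The triangle with edge vectors \<open>cross2 u\<^sub>2 u\<^sub>3 *\<^sub>R u\<^sub>1\<close> etc. has circumdiameter 1, and the vectors from its
  orthocenter to its vertices have the cosines of the angles as lengths. Writing the edges as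
  differences of these three vectors turns the left-hand side into a combination of the differences of the points, which is how the
  mutual distances of the centers of the generating disks enter.\<close>

lemma orthocenter_decomp:
  assumes "norm u\<^sub>1 = 1" "norm u\<^sub>2 = 1" "norm u\<^sub>3 = 1"
  shows "cross2 u\<^sub>2 u\<^sub>3 * inner u\<^sub>1 z\<^sub>1 + cross2 u\<^sub>3 u\<^sub>1 * inner u\<^sub>2 z\<^sub>2 + cross2 u\<^sub>1 u\<^sub>2 * inner u\<^sub>3 z\<^sub>3
    = - inner u\<^sub>1 u\<^sub>2 * inner (rot u\<^sub>3) (z\<^sub>1 - z\<^sub>2) - inner u\<^sub>2 u\<^sub>3 * inner (rot u\<^sub>1) (z\<^sub>2 - z\<^sub>3)
      - inner u\<^sub>3 u\<^sub>1 * inner (rot u\<^sub>2) (z\<^sub>3 - z\<^sub>1)"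
proof -
  have *: "cross2 v w * inner u z = inner w u * inner (rot v) z - inner u v * inner (rot w) z" for u v w z
    unfolding coords by algebra
  show ?thesis
    using *[of u\<^sub>2 u\<^sub>3 u\<^sub>1 z\<^sub>1] *[of u\<^sub>3 u\<^sub>1 u\<^sub>2 z\<^sub>2] *[of u\<^sub>1 u\<^sub>2 u\<^sub>3 z\<^sub>3]
    by (simp add: inner_diff_right algebra_simps)
qed

text \<open>When one vector of the triple is moved, only the sign conditions on the inner products are
  controlled; the orientation is recovered from them.\<close>

lemma nonobtuseI:
  assumes n: "norm u\<^sub>1 = 1" "norm u\<^sub>2 = 1" "norm u\<^sub>3 = 1"
    and s: "cross2 u\<^sub>2 u\<^sub>3 > 0"
    and c: "inner u\<^sub>2 u\<^sub>3 \<le> 0" "inner u\<^sub>3 u\<^sub>1 \<le> 0" "inner u\<^sub>1 u\<^sub>2 \<le> 0"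
  shows "nonobtuse u\<^sub>1 u\<^sub>2 u\<^sub>3"
proof -
  have 1: "0 < cross2 u\<^sub>3 u\<^sub>1 * - inner u\<^sub>1 u\<^sub>2 + cross2 u\<^sub>1 u\<^sub>2 * - inner u\<^sub>3 u\<^sub>1"
    using unit_triple_sines(1)[OF n] s by simp
  have "0 \<le> inner u\<^sub>1 u\<^sub>2 * inner u\<^sub>3 u\<^sub>1" using c by (simp add: mult_nonpos_nonpos)
  then have 2: "0 \<le> cross2 u\<^sub>3 u\<^sub>1 * cross2 u\<^sub>1 u\<^sub>2"
    using unit_triple_sines(2)[OF n] c(1) by linarith
  have "0 \<le> cross2 u\<^sub>3 u\<^sub>1 \<and> 0 \<le> cross2 u\<^sub>1 u\<^sub>2"
  proof (rule ccontr)
    assume "\<not> ?thesis"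
    then have "cross2 u\<^sub>3 u\<^sub>1 \<le> 0" "cross2 u\<^sub>1 u\<^sub>2 \<le> 0"
      using 2 by (auto simp: zero_le_mult_iff)
    then have "cross2 u\<^sub>3 u\<^sub>1 * - inner u\<^sub>1 u\<^sub>2 \<le> 0" "cross2 u\<^sub>1 u\<^sub>2 * - inner u\<^sub>3 u\<^sub>1 \<le> 0"
      using c by (simp_all add: mult_nonpos_nonneg mult_nonpos_nonpos)
    then show False using 1 by linarith
  qed
  then show ?thesis using assms by (simp add: nonobtuse_def)
qed

lemma acute_nonobtuse_cross_pos:
  assumes non: "nonobtuse u\<^sub>1 u\<^sub>2 u\<^sub>3" and ac: "acute u\<^sub>1 u\<^sub>2 u\<^sub>3"
  shows "0 < cross2 u\<^sub>2 u\<^sub>3"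
proof (rule ccontr)
  have n: "norm u\<^sub>1 = 1" "norm u\<^sub>2 = 1" "norm u\<^sub>3 = 1"
    and s: "0 \<le> cross2 u\<^sub>2 u\<^sub>3" "0 \<le> cross2 u\<^sub>3 u\<^sub>1" "0 \<le> cross2 u\<^sub>1 u\<^sub>2"
    using non by (auto simp: nonobtuse_def)
  have c: "0 < - inner u\<^sub>2 u\<^sub>3" "0 < - inner u\<^sub>3 u\<^sub>1" "0 < - inner u\<^sub>1 u\<^sub>2" using ac by (auto simp: acute_def)
  assume "\<not> 0 < cross2 u\<^sub>2 u\<^sub>3"
  then have "cross2 u\<^sub>3 u\<^sub>1 * - inner u\<^sub>1 u\<^sub>2 + cross2 u\<^sub>1 u\<^sub>2 * - inner u\<^sub>3 u\<^sub>1 = 0"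
    using unit_triple_sines(1)[OF n] s by simp
  moreover have "0 \<le> cross2 u\<^sub>3 u\<^sub>1 * - inner u\<^sub>1 u\<^sub>2" "0 \<le> cross2 u\<^sub>1 u\<^sub>2 * - inner u\<^sub>3 u\<^sub>1"
    using s c by (metis mult_nonneg_nonneg less_imp_le)+
  ultimately have "cross2 u\<^sub>3 u\<^sub>1 * - inner u\<^sub>1 u\<^sub>2 = 0" by linarith
  then have "cross2 u\<^sub>3 u\<^sub>1 = 0" using c by simp
  then have "- inner u\<^sub>2 u\<^sub>3 = - (inner u\<^sub>1 u\<^sub>2 * inner u\<^sub>3 u\<^sub>1)" using unit_triple_sines(2)[OF n] by simp
  moreover have "0 < inner u\<^sub>1 u\<^sub>2 * inner u\<^sub>3 u\<^sub>1" using c by (simp add: mult_neg_neg)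
  ultimately show False using c by linarith
qed

lemma inner_less_1_unit:
  assumes "norm a = 1" "norm b = 1" "a \<noteq> b"
  shows "inner a b < 1"
proof -
  have "0 < inner (a - b) (a - b)" using assms by simp
  then show ?thesis using assms by (simp add: inner_simps norm_eq_1 inner_commute)
qed

lemma unit_parallel:
  assumes "norm a = 1" "norm b = 1" "cross2 a b = 0" 
  shows "a = b \<or> a = - b"
proof (rule ccontr)
  assume "\<not> ?thesis"
  then have "inner a b < 1" "inner a (- b) < 1" using inner_less_1_unit assms by (metis norm_minus_cancel)+
  moreover have "(inner a b)\<^sup>2 = 1" using cross2_inner_Pythagoras[OF assms(1,2)] assms(3) by simp
  ultimately show False by (auto simp: power2_eq_1_iff)
qed

text \<open>If no two of the vectors are opposite, the origin is interior to their convex hull, so they turn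
  consistently in one direction.\<close>

lemma positive_relation_cases:
  assumes n: "norm a = 1" "norm b = 1" "norm c = 1"
    and nn: "0 \<le> \<alpha>" "0 \<le> \<beta>" "0 \<le> \<gamma>" "\<alpha> + \<beta> + \<gamma> = 1"
    and rel: "\<alpha> *\<^sub>R a + \<beta> *\<^sub>R b + \<gamma> *\<^sub>R c = 0"
  shows "a = - b \<or> b = - c \<or> c = - a \<or>
    (0 < cross2 b c \<and> 0 < cross2 c a \<and> 0 < cross2 a b) \<or>
    (cross2 b c < 0 \<and> cross2 c a < 0 \<and> cross2 a b < 0)"
proof -
  have two: "x = - y" if "norm x = 1" "norm y = 1" "0 \<le> s" "0 \<le> t" "s + t = 1" "s *\<^sub>R x + t *\<^sub>R y = 0"
    for x y :: "real ^ 2" and s t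
  proof -
    have e: "s *\<^sub>R x = - (t *\<^sub>R y)" using that by (simp add: add_eq_0_iff2)
    then have "norm (s *\<^sub>R x) = norm (t *\<^sub>R y)" by (metis norm_minus_cancel)
    then have "s = t" using that by simp
    then show ?thesis using e that by (metis scaleR_minus_right scaleR_cancel_left add_0 zero_neq_one)
  qed
  show ?thesis
  proof (cases "\<alpha> = 0 \<or> \<beta> = 0 \<or> \<gamma> = 0")
    case True
    then show ?thesis using two[OF n(2,3), of \<beta> \<gamma>] two[OF n(3,1), of \<gamma> \<alpha>] two[OF n(1,2), of \<alpha> \<beta>] nn rel
      by (auto simp: add.commute)
  next
    case False
    then have pos: "0 < \<alpha>" "0 < \<beta>" "0 < \<gamma>" using nn by auto
    have "cross2 a (\<alpha> *\<^sub>R a + \<beta> *\<^sub>R b + \<gamma> *\<^sub>R c) = 0" "cross2 b (\<alpha> *\<^sub>R a + \<beta> *\<^sub>R b + \<gamma> *\<^sub>R c) = 0"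
      unfolding rel by (simp_all add: cross2_def)
    then have e: "\<beta> * cross2 a b = \<gamma> * cross2 c a" "\<alpha> * cross2 a b = \<gamma> * cross2 b c"
      by (simp_all add: cross2_def algebra_simps)
    consider "cross2 a b = 0" | "0 < cross2 a b" | "cross2 a b < 0" by linarith
    then show ?thesis
    proof cases
      case 1
      then have "cross2 b c = 0" using e pos by simp
      then have "(a = b \<or> a = - b) \<and> (b = c \<or> b = - c)" using unit_parallel n 1 by blast
      moreover have "\<not> (a = b \<and> b = c)"
      proof
        assume "a = b \<and> b = c"
        then have "(\<alpha> + \<beta> + \<gamma>) *\<^sub>R a = 0" using rel by (simp add: scaleR_add_left)
        then show False using nn n by simp
      qed
      ultimately show ?thesis by auto
    next
      case 2
      then have "0 < \<gamma> * cross2 c a" "0 < \<gamma> * cross2 b c" using e pos by (metis mult_pos_pos)+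
      then show ?thesis using 2 pos by (simp add: zero_less_mult_iff)
    next
      case 3
      then have "\<gamma> * cross2 c a < 0" "\<gamma> * cross2 b c < 0" using e pos by (metis mult_pos_neg)+
      then show ?thesis using 3 pos by (simp add: mult_less_0_iff)
    qed
  qed
qed

text \<open>The unit vector \<open>u\<close> is rotated towards \<open>v\<close> until \<open>v\<close> is reached or the angle with \<open>b\<close> or \<open>c\<close> becomes
  right. The vector \<open>g\<close> keeps the segment from \<open>u\<close> to \<open>v\<close> away from the origin.\<close>

lemma unit_vector_towards:
  fixes u v b c g :: "'a :: real_inner"
  assumes n: "norm v = 1"
    and g: "0 < inner u g" "0 < inner v g" and u: "inner u b < 0" "inner u c < 0"
  obtains a \<kappa> t where "0 < \<kappa>" "0 < t" "t \<le> 1" "a = \<kappa> *\<^sub>R ((1 - t) *\<^sub>R u + t *\<^sub>R v)" "norm a = 1"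
    "inner a b \<le> 0" "inner a c \<le> 0" "a = v \<or> inner a b = 0 \<or> inner a c = 0"
proof -
  \<comment> \<open>The parameter at which the inner product with d vanishes, or 1 if this does not happen before v.\<close>
  define f where "f d = (if inner v d \<le> 0 then 1 else inner u d / (inner u d - inner v d))" for d
  have f: "0 < f d \<and> f d \<le> 1 \<and> (inner v d \<le> 0 \<longleftrightarrow> f d = 1) \<and>
      (f d < 1 \<longrightarrow> inner ((1 - f d) *\<^sub>R u + f d *\<^sub>R v) d = 0)" if "inner u d < 0" for d
    using that by (auto simp: f_def inner_simps field_simps)
  have below: "inner ((1 - s) *\<^sub>R u + s *\<^sub>R v) d \<le> 0" if d: "inner u d < 0" and s: "0 < s" "s \<le> f d" for d s
  proof (cases "inner v d \<le> 0")
    case True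
    then have "s \<le> 1" using s by (simp add: f_def)
    then show ?thesis using True d s by (simp add: inner_simps add_nonpos_nonpos mult_nonneg_nonpos)
  next
    case False
    then have "s * (inner u d - inner v d) \<ge> inner u d"
      using s(2) d by (simp add: f_def neg_le_divide_eq)
    then show ?thesis by (simp add: inner_simps algebra_simps)
  qed
  define t where "t = min (f b) (f c)"
  have t: "0 < t" "t \<le> 1" "t \<le> f b" "t \<le> f c" using f[OF u(1)] f[OF u(2)] by (auto simp: t_def)
  define y where "y = (1 - t) *\<^sub>R u + t *\<^sub>R v"
  have "0 < inner y g"
    using t g by (simp add: y_def inner_simps add_nonneg_pos)
  then have y0: "y \<noteq> 0" by auto
  have yb: "inner y b \<le> 0" "inner y c \<le> 0" using below u t by (auto simp: y_def)
  have alt: "y = v \<or> inner y b = 0 \<or> inner y c = 0"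
  proof (cases "t = 1")
    case True then show ?thesis by (simp add: y_def)
  next
    case False
    then show ?thesis using f[OF u(1)] f[OF u(2)] t(2) by (auto simp: y_def t_def min_def split: if_splits)
  qed
  show thesis
  proof (rule that[of "1 / norm y" t "(1 / norm y) *\<^sub>R y"])
    show "(1 / norm y) *\<^sub>R y = v \<or> inner ((1 / norm y) *\<^sub>R y) b = 0 \<or> inner ((1 / norm y) *\<^sub>R y) c = 0"
      using alt n by auto
  qed (use t y0 yb in \<open>auto simp: y_def[symmetric] divide_nonpos_nonneg\<close>)
qed

section \<open>Support functions\<close>

definition supp :: "'a :: real_inner set \<Rightarrow> 'a \<Rightarrow> real" where
  "supp S u = (SUP x\<in>S. inner u x)"

lemma inner_le_supp:
  assumes "compact S" "x \<in> S"
  shows "inner u x \<le> supp S u"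
proof -
  have "compact ((inner u) ` S)"
    using assms by (intro compact_continuous_image continuous_intros) auto
  then have "bdd_above ((inner u) ` S)"
    by (simp add: bounded_imp_bdd_above compact_imp_bounded)
  then show ?thesis unfolding supp_def using assms by (intro cSUP_upper)
qed

lemma supp_eqI:
  assumes "x \<in> S" "\<And>y. y \<in> S \<Longrightarrow> inner u y \<le> inner u x"
  shows "supp S u = inner u x"
  unfolding supp_def using assms by (intro cSup_eq_maximum) auto

lemma supp_attained:
  assumes "compact S" "S \<noteq> {}"
  obtains x where "x \<in> S" "supp S u = inner u x"
proof -
  obtain x where "x \<in> S" "\<forall>y\<in>S. inner u y \<le> inner u x"
    using continuous_attains_sup[OF assms, of "inner u"] continuous_on_inner[OF continuous_on_const continuous_on_id]
    by blast
  then show thesis using supp_eqI that by metis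
qed

section \<open>Circumscribed triangles of parallel bodies of disk intersections\<close>

text \<open>Here \<open>X\<close> is the set of centers of the generating disks of a fat disk-polygon with parameter
  \<open>\<rho> + \<epsilon>\<close>. The \<open>\<epsilon>\<close>-rounded disk-polygon is the outer parallel body at distance \<open>\<epsilon>\<close> of the intersection
  \<open>E\<close> of the concentric disks of radius \<open>\<rho>\<close>. The number \<open>w\<close> is a lower bound for the width of
  this body in every direction, and \<open>x\<^sub>0\<close> is an interior point of \<open>E\<close>.\<close>

locale parallel_disk_intersection =
  fixes X :: "(real ^ 2) set" and \<rho> \<epsilon> w :: real and x\<^sub>0 :: "real ^ 2"
  assumes fin: "finite X" and ne: "X \<noteq> {}" and eps: "0 < \<epsilon>"
    and slater: "c \<in> X \<Longrightarrow> dist c x\<^sub>0 < \<rho>"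
    and fat: "a \<in> X \<Longrightarrow> b \<in> X \<Longrightarrow> dist a b \<le> \<rho> + \<epsilon>"
    and width: "norm v = 1 \<Longrightarrow>
      w \<le> supp (\<Inter>c\<in>X. cball c \<rho>) v + supp (\<Inter>c\<in>X. cball c \<rho>) (- v) + 2 * \<epsilon>"
    and w_ge: "2 * \<epsilon> \<le> w"
begin

definition E :: "(real ^ 2) set" where "E = (\<Inter>c\<in>X. cball c \<rho>)"

text \<open>On unit vectors this is the support function of the parallel body of \<open>E\<close>.\<close>

definition h :: "real ^ 2 \<Rightarrow> real" where "h u = supp E u + \<epsilon>"

text \<open>If the three lines supporting the parallel body with outer normals u1, u2, u3 form an acute triangle,
  this is half the perimeter of its orthic triangle; if the angle A1 is right, it is the altitude
  from that vertex.\<close>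

definition Phi :: "real ^ 2 \<Rightarrow> real ^ 2 \<Rightarrow> real ^ 2 \<Rightarrow> real" where
  "Phi u\<^sub>1 u\<^sub>2 u\<^sub>3 = cross2 u\<^sub>2 u\<^sub>3 * h u\<^sub>1 + cross2 u\<^sub>3 u\<^sub>1 * h u\<^sub>2 + cross2 u\<^sub>1 u\<^sub>2 * h u\<^sub>3"

lemma Phi_rotate: "Phi u\<^sub>2 u\<^sub>3 u\<^sub>1 = Phi u\<^sub>1 u\<^sub>2 u\<^sub>3"
  by (simp add: Phi_def)

lemma rho_pos: "0 < \<rho>"
  using ne slater by (metis ex_in_conv le_less_trans zero_le_dist)

lemma compact_E: "compact E"
proof -
  obtain c where "c \<in> X" using ne by auto
  then have "E = cball c \<rho> \<inter> (\<Inter>c\<in>X. cball c \<rho>)" by (auto simp: E_def)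
  then show ?thesis by (metis closed_INT closed_cball compact_Int_closed compact_cball)
qed

lemma x0_in_E: "x\<^sub>0 \<in> E"
  using slater by (force simp: E_def)

lemma h_width: "norm v = 1 \<Longrightarrow> w \<le> h v + h (- v)"
  using width[of v] by (simp add: h_def E_def)

lemma inner_le_ball:
  assumes "norm v = 1" "c \<in> X" "x \<in> E"
  shows "inner v x \<le> inner v c + \<rho>"
proof -
  have "inner v (x - c) \<le> dist x c" using assms by (intro inner_le_dist) auto
  also have "\<dots> \<le> \<rho>" using assms by (auto simp: E_def dist_commute)
  finally show ?thesis by (simp add: inner_diff_right)
qed

lemma h_le_ball:
  assumes "norm v = 1" "c \<in> X"
  shows "h v \<le> inner v c + (\<rho> + \<epsilon>)"
proof -
  obtain x where "x \<in> E" "supp E v = inner v x"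
    using supp_attained compact_E x0_in_E by blast
  then show ?thesis using inner_le_ball[OF assms] by (simp add: h_def)
qed

text \<open>The outer normals at \<open>q\<close> of those generating circles of \<open>E\<close> that pass through \<open>q\<close>.\<close>

definition arc_normals :: "real ^ 2 \<Rightarrow> (real ^ 2) set" where
  "arc_normals q = {v. norm v = 1 \<and> q \<in> E \<and> q - \<rho> *\<^sub>R v \<in> X}"

lemma h_arc_normal:
  assumes "v \<in> arc_normals q"
  shows "h v = inner v q + \<epsilon>"
proof -
  have v: "norm v = 1" "q \<in> E" "q - \<rho> *\<^sub>R v \<in> X" using assms by (auto simp: arc_normals_def)
  have "inner v y \<le> inner v q" if "y \<in> E" for y
    using inner_le_ball[OF v(1,3) that] v(1) by (simp add: inner_diff_right norm_eq_1)
  then show ?thesis using supp_eqI[OF v(2)] by (simp add: h_def)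
qed

lemma arc_normal_center:
  assumes "v \<in> arc_normals q"
  obtains c where "c \<in> X" "h v = inner v c + (\<rho> + \<epsilon>)"
proof
  show "q - \<rho> *\<^sub>R v \<in> X" using assms by (auto simp: arc_normals_def)
  show "h v = inner v (q - \<rho> *\<^sub>R v) + (\<rho> + \<epsilon>)"
    using assms h_arc_normal[OF assms] by (simp add: arc_normals_def inner_diff_right norm_eq_1)
qed

text \<open>The two claims are kept together because the weak inequality at the two ends of an arc of normals
  forces the strict one in between.\<close>

definition wide :: "real ^ 2 \<Rightarrow> real ^ 2 \<Rightarrow> real ^ 2 \<Rightarrow> bool" where
  "wide u\<^sub>1 u\<^sub>2 u\<^sub>3 \<longleftrightarrow> w \<le> Phi u\<^sub>1 u\<^sub>2 u\<^sub>3 \<and> (acute u\<^sub>1 u\<^sub>2 u\<^sub>3 \<longrightarrow> w < Phi u\<^sub>1 u\<^sub>2 u\<^sub>3)"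

lemma wide_rotate: "wide u\<^sub>1 u\<^sub>2 u\<^sub>3 \<Longrightarrow> wide u\<^sub>2 u\<^sub>3 u\<^sub>1"
  using acute_rotate by (auto simp: wide_def Phi_rotate)

text \<open>The parallel body lies in two disks of radius \<open>\<rho> + \<epsilon>\<close> with centers \<open>a\<close> and \<open>b\<close>, and such a lens has
  this width in the direction of its centers.\<close>

lemma width_le_center_dist:
  assumes "a \<in> X" "b \<in> X"
  shows "w \<le> 2 * (\<rho> + \<epsilon>) - dist a b"
proof -
  obtain v :: "real ^ 2" where v: "norm v = 1" "inner v (b - a) = - dist a b"
  proof (cases "a = b")
    case True
    obtain v :: "real ^ 2" where "norm v = 1" using vector_choose_size[of 1] by auto
    then show thesis using that[of v] True by simp
  next
    case False
    have "inner (sgn (a - b)) (b - a) = - (inner (a - b) (a - b) / norm (a - b))"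
      by (simp add: sgn_div_norm inner_diff_right divide_inverse algebra_simps)
    also have "\<dots> = - dist a b"
      by (simp add: dist_norm norm_eq_sqrt_inner real_div_sqrt)
    finally have "inner (sgn (a - b)) (b - a) = - dist a b" .
    then show thesis using that[of "sgn (a - b)"] False by (simp add: norm_sgn)
  qed
  have "w \<le> h v + h (- v)" using h_width v by simp
  also have "\<dots> \<le> (inner v b + (\<rho> + \<epsilon>)) + (inner (- v) a + (\<rho> + \<epsilon>))"
    using v assms by (intro add_mono h_le_ball) auto
  finally show ?thesis using v(2) by (simp add: inner_diff_right)
qed

text \<open>This is where fatness is used. Write r = \<open>\<rho> + \<epsilon>\<close>, let S and C be the sums of the sines and cosines
  of the angles, and let m \<le> r be the largest distance between the three centers involved. Then \<open>Phi\<close> is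
  at least r S - m C by the decomposition at the orthocenter, while w \<le> 2 r - m. The difference of
  the two bounds is at least r (S - 2) - m (C - 1) \<ge> r (S - 1 - C), which is nonnegative.\<close>

lemma wide_if_arc_normals:
  assumes non: "nonobtuse u\<^sub>1 u\<^sub>2 u\<^sub>3"
    and arc: "u\<^sub>1 \<in> arc_normals q\<^sub>1" "u\<^sub>2 \<in> arc_normals q\<^sub>2" "u\<^sub>3 \<in> arc_normals q\<^sub>3"
  shows "wide u\<^sub>1 u\<^sub>2 u\<^sub>3"
proof -
  define r where "r = \<rho> + \<epsilon>"
  obtain z1 z2 z3 where z: "z1 \<in> X" "z2 \<in> X" "z3 \<in> X"
    and hz: "h u\<^sub>1 = inner u\<^sub>1 z1 + r" "h u\<^sub>2 = inner u\<^sub>2 z2 + r" "h u\<^sub>3 = inner u\<^sub>3 z3 + r"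
    using arc arc_normal_center unfolding r_def by metis
  define S where "S = cross2 u\<^sub>2 u\<^sub>3 + cross2 u\<^sub>3 u\<^sub>1 + cross2 u\<^sub>1 u\<^sub>2"
  define C where "C = - inner u\<^sub>2 u\<^sub>3 - inner u\<^sub>3 u\<^sub>1 - inner u\<^sub>1 u\<^sub>2"
  have n: "norm u\<^sub>1 = 1" "norm u\<^sub>2 = 1" "norm u\<^sub>3 = 1" using non by (auto simp: nonobtuse_def)
  define m where "m = max (dist z1 z2) (max (dist z2 z3) (dist z3 z1))"
  have "\<exists>a\<in>X. \<exists>b\<in>X. m = dist a b" using z by (auto simp: m_def max_def)
  then have m: "w \<le> 2 * r - m" "m \<le> r"
    using width_le_center_dist fat by (auto simp: r_def)
  have r0: "r > 0" using rho_pos eps by (simp add: r_def)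
  have lower: "- inner (rot u) (a - b) \<le> m" if "norm u = 1" "dist a b \<le> m" for u a b
    using inner_le_dist[of "rot u" b a] that by (simp add: dist_commute inner_diff_right)
  have "- (C * m) \<le> - inner u\<^sub>1 u\<^sub>2 * inner (rot u\<^sub>3) (z1 - z2) - inner u\<^sub>2 u\<^sub>3 * inner (rot u\<^sub>1) (z2 - z3)
      - inner u\<^sub>3 u\<^sub>1 * inner (rot u\<^sub>2) (z3 - z1)"
  proof -
    have 1: "- inner u\<^sub>1 u\<^sub>2 * (- inner (rot u\<^sub>3) (z1 - z2)) \<le> - inner u\<^sub>1 u\<^sub>2 * m"
      using lower[OF n(3), of z1 z2] non by (intro mult_left_mono) (auto simp: m_def nonobtuse_def)
    have 2: "- inner u\<^sub>2 u\<^sub>3 * (- inner (rot u\<^sub>1) (z2 - z3)) \<le> - inner u\<^sub>2 u\<^sub>3 * m"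
      using lower[OF n(1), of z2 z3] non by (intro mult_left_mono) (auto simp: m_def nonobtuse_def)
    have 3: "- inner u\<^sub>3 u\<^sub>1 * (- inner (rot u\<^sub>2) (z3 - z1)) \<le> - inner u\<^sub>3 u\<^sub>1 * m"
      using lower[OF n(2), of z3 z1] non by (intro mult_left_mono) (auto simp: m_def nonobtuse_def)
    have "C * m = - inner u\<^sub>1 u\<^sub>2 * m + - inner u\<^sub>2 u\<^sub>3 * m + - inner u\<^sub>3 u\<^sub>1 * m"
      by (simp add: C_def algebra_simps)
    then show ?thesis using 1 2 3 by linarith
  qed
  moreover have "Phi u\<^sub>1 u\<^sub>2 u\<^sub>3 = r * S + (cross2 u\<^sub>2 u\<^sub>3 * inner u\<^sub>1 z1
      + cross2 u\<^sub>3 u\<^sub>1 * inner u\<^sub>2 z2 + cross2 u\<^sub>1 u\<^sub>2 * inner u\<^sub>3 z3)"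
    by (simp add: Phi_def hz S_def algebra_simps)
  ultimately have low: "r * S - C * m \<le> Phi u\<^sub>1 u\<^sub>2 u\<^sub>3"
    using orthocenter_decomp[OF n, of z1 z2 z3] by linarith
  note SC = nonobtuse_sum_sines[OF non, folded S_def C_def]
  have "m * (C - 1) \<le> r * (C - 1)" using SC(1) m(2) by (intro mult_right_mono) auto
  then have gap: "w + r * (S - (1 + C)) \<le> r * S - C * m"
    using m(1) by (simp add: algebra_simps)
  have "r * (S - (1 + C)) \<ge> 0" using SC(2) r0 by simp
  moreover have "r * (S - (1 + C)) > 0" if "acute u\<^sub>1 u\<^sub>2 u\<^sub>3" using SC(3)[OF that] r0 by simp
  ultimately show ?thesis using gap low by (force simp: wide_def)
qed

text \<open>The vector \<open>- u\<^sub>1\<close>, scaled by \<open>cross2 u\<^sub>2 u\<^sub>3\<close>, is a nonnegative combination of \<open>u\<^sub>2\<close> and \<open>u\<^sub>3\<close>, so sublinearity of the support function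
  of \<open>E\<close> compares the altitude of the circumscribed triangle with the width in direction \<open>u\<^sub>1\<close>. The
  additional \<open>\<epsilon>\<close>-term comes from rounding the corners: it makes the comparison strict for nondegenerate
  triangles.\<close>

lemma Phi_ge_altitude:
  assumes n: "norm u\<^sub>1 = 1"
    and s: "cross2 u\<^sub>2 u\<^sub>3 \<ge> 0" "cross2 u\<^sub>3 u\<^sub>1 \<ge> 0" "cross2 u\<^sub>1 u\<^sub>2 \<ge> 0"
  shows "cross2 u\<^sub>2 u\<^sub>3 * w + \<epsilon> * (cross2 u\<^sub>3 u\<^sub>1 + cross2 u\<^sub>1 u\<^sub>2 - cross2 u\<^sub>2 u\<^sub>3) \<le> Phi u\<^sub>1 u\<^sub>2 u\<^sub>3"
proof -
  define s1 s2 s3 where s': "s1 = cross2 u\<^sub>2 u\<^sub>3" "s2 = cross2 u\<^sub>3 u\<^sub>1" "s3 = cross2 u\<^sub>1 u\<^sub>2"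
  \<comment> \<open>The point of E farthest in the direction opposite to the first side.\<close>
  obtain x where x: "x \<in> E" "supp E (- u\<^sub>1) = inner (- u\<^sub>1) x"
    using supp_attained compact_E x0_in_E by blast
  have "s1 *\<^sub>R u\<^sub>1 + s2 *\<^sub>R u\<^sub>2 + s3 *\<^sub>R u\<^sub>3 = 0" using cross2_cyclic by (simp add: s')
  then have "inner (s1 *\<^sub>R u\<^sub>1 + s2 *\<^sub>R u\<^sub>2 + s3 *\<^sub>R u\<^sub>3) x = 0" by simp
  then have "s1 * supp E (- u\<^sub>1) = s2 * inner u\<^sub>2 x + s3 * inner u\<^sub>3 x"
    by (simp add: x inner_simps)
  also have "\<dots> \<le> s2 * supp E u\<^sub>2 + s3 * supp E u\<^sub>3"
    using s s' x compact_E by (intro add_mono mult_left_mono inner_le_supp) auto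
  finally have "s1 * supp E (- u\<^sub>1) \<le> s2 * supp E u\<^sub>2 + s3 * supp E u\<^sub>3" .
  moreover have "s1 * w \<le> s1 * (h u\<^sub>1 + h (- u\<^sub>1))"
    using h_width n s by (intro mult_left_mono) (auto simp: s')
  ultimately show ?thesis
    unfolding Phi_def s'[symmetric] h_def by (simp add: algebra_simps)
qed

lemma wide_if_right_angle:
  assumes non: "nonobtuse u\<^sub>1 u\<^sub>2 u\<^sub>3" and ac: "\<not> acute u\<^sub>1 u\<^sub>2 u\<^sub>3"
  shows "wide u\<^sub>1 u\<^sub>2 u\<^sub>3"
proof -
  have right: "w \<le> Phi a b c" if non: "nonobtuse a b c" and "inner b c = 0" for a b c
  proof -
    have n: "norm a = 1" "norm b = 1" "norm c = 1"
      and s: "0 \<le> cross2 b c" "0 \<le> cross2 c a" "0 \<le> cross2 a b"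
      using non by (auto simp: nonobtuse_def)
    have "(cross2 b c)\<^sup>2 = 1" using unit_triple_sines(3)[OF n] \<open>inner b c = 0\<close> by simp
    then have s1: "cross2 b c = 1" using s by (simp add: power2_eq_1_iff)
    have le1: "- inner a b \<le> 1" "- inner c a \<le> 1"
      using Cauchy_Schwarz_ineq2[of a b] Cauchy_Schwarz_ineq2[of c a] n by simp_all
    have "1 = cross2 c a * - inner a b + cross2 a b * - inner c a"
      using unit_triple_sines(1)[OF n] s1 by simp
    also have "\<dots> \<le> cross2 c a * 1 + cross2 a b * 1"
      using le1 s by (intro add_mono mult_left_mono)
    finally have "0 \<le> \<epsilon> * (cross2 c a + cross2 a b - cross2 b c)" using s1 eps by simp
    then show ?thesis using Phi_ge_altitude[OF n(1) s] s1 by simp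
  qed
  have "inner u\<^sub>2 u\<^sub>3 = 0 \<or> inner u\<^sub>3 u\<^sub>1 = 0 \<or> inner u\<^sub>1 u\<^sub>2 = 0"
    using non ac by (auto simp: nonobtuse_def acute_def)
  then have "w \<le> Phi u\<^sub>1 u\<^sub>2 u\<^sub>3"
    using right[OF non] right[OF nonobtuse_rotate[OF non]]
      right[OF nonobtuse_rotate[OF nonobtuse_rotate[OF non]]] by (auto simp: Phi_rotate)
  then show ?thesis using ac by (simp add: wide_def)
qed

text \<open>Since \<open>E\<close> has an interior point, its normal cones are pointed.\<close>

lemma arc_normal_halfplane:
  assumes "v \<in> arc_normals q"
  shows "0 < inner v (q - x\<^sub>0)"
proof -
  have n: "norm v = 1" "q - \<rho> *\<^sub>R v \<in> X" using assms by (auto simp: arc_normals_def)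
  have "inner v (x\<^sub>0 - (q - \<rho> *\<^sub>R v)) \<le> dist x\<^sub>0 (q - \<rho> *\<^sub>R v)" using n by (intro inner_le_dist) simp
  also have "\<dots> < \<rho>" using slater[OF n(2)] by (simp add: dist_commute)
  finally show ?thesis using n(1) by (simp add: inner_simps norm_eq_1)
qed

text \<open>The normal cone of \<open>E\<close> at \<open>q\<close> is generated by the radii towards \<open>q\<close> of the circles through \<open>q\<close>. In the
  plane two radii suffice: one on each side of \<open>u\<close>. If all of them lay strictly on one side, then \<open>q\<close>
  could be moved inside \<open>E\<close> almost orthogonally to \<open>u\<close>, and slightly in the direction of \<open>u\<close>,
  contradicting that \<open>q\<close> is extreme in direction \<open>u\<close>.\<close>

lemma normal_cone_generators:
  assumes q: "q \<in> E" and u: "norm u = 1" "h u = inner u q + \<epsilon>"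
  obtains v v' \<alpha> \<beta> where "v \<in> arc_normals q" "v' \<in> arc_normals q" "0 \<le> \<alpha>" "0 \<le> \<beta>"
    "u = \<alpha> *\<^sub>R v + \<beta> *\<^sub>R v'"
proof -
  have side: "\<exists>v\<in>arc_normals q. 0 \<le> inner j v" if j: "inner u j = 0" for j
  proof (rule ccontr)
    assume neg: "\<not> (\<exists>v\<in>arc_normals q. 0 \<le> inner j v)"
    have "\<exists>t>0. \<forall>\<eta>. 0 < \<eta> \<and> \<eta> < t \<longrightarrow> dist c (q + \<eta> *\<^sub>R (j + \<eta> *\<^sub>R u)) \<le> \<rho>" if c: "c \<in> X" for c
    proof (cases "dist c q = \<rho>")
      case True
      define v where "v = (1 / \<rho>) *\<^sub>R (q - c)"
      have "v \<in> arc_normals q"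
        using True c q rho_pos by (simp add: arc_normals_def v_def dist_norm norm_minus_commute)
      then have "inner j v < 0" using neg by force
      then have jc: "inner j (q - c) < 0" using rho_pos by (simp add: v_def divide_less_0_iff del: scaleR_diff_right)
      \<comment> \<open>The increment of the squared distance to c, divided by \<open>\<eta>\<close>.\<close>
      define G where "G \<eta> = 2 * (inner j (q - c) + \<eta> * inner u (q - c)) + \<eta> * ((norm (j + \<eta> *\<^sub>R u))\<^sup>2)" for \<eta>
      have "(G \<longlongrightarrow> G 0) (at_right 0)" unfolding G_def by (intro tendsto_intros) 
      moreover have "G 0 < 0" using jc by (simp add: G_def)
      ultimately have "\<forall>\<^sub>F \<eta> in at_right 0. G \<eta> < 0" by (rule order_tendstoD)
      then obtain t where t: "t > 0" "\<And>\<eta>. 0 < \<eta> \<Longrightarrow> \<eta> < t \<Longrightarrow> G \<eta> < 0"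
        unfolding eventually_at_right_field by auto
      have "dist c (q + \<eta> *\<^sub>R (j + \<eta> *\<^sub>R u)) \<le> \<rho>" if "0 < \<eta>" "\<eta> < t" for \<eta>
      proof -
        have "(dist c (q + \<eta> *\<^sub>R (j + \<eta> *\<^sub>R u)))\<^sup>2
            = (norm ((q - c) + \<eta> *\<^sub>R (j + \<eta> *\<^sub>R u)))\<^sup>2"
          by (metis (no_types, opaque_lifting) add_diff_eq diff_add_eq dist_commute dist_norm)
        also have "\<dots> = (dist c q)\<^sup>2 + \<eta> * G \<eta>"
          unfolding G_def power2_norm_eq_inner dist_norm norm_minus_commute[of c q]
          by (simp add: inner_simps inner_commute algebra_simps)
        also have "\<dots> \<le> \<rho>\<^sup>2" using True t(2)[OF that] that by (simp add: mult_pos_neg less_imp_le)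
        finally show ?thesis by (rule power2_le_imp_le) (use rho_pos in simp)
      qed
      then show ?thesis using t(1) by auto
    next
      case False
      then have "dist c q < \<rho>" using q c by (force simp: E_def)
      have "((\<lambda>\<eta>. dist c (q + \<eta> *\<^sub>R (j + \<eta> *\<^sub>R u))) \<longlongrightarrow> dist c (q + 0 *\<^sub>R (j + 0 *\<^sub>R u))) (at_right 0)"
        by (intro tendsto_intros)
      then have "\<forall>\<^sub>F \<eta> in at_right 0. dist c (q + \<eta> *\<^sub>R (j + \<eta> *\<^sub>R u)) < \<rho>"
        by (rule order_tendstoD) (use \<open>dist c q < \<rho>\<close> in simp)
      then show ?thesis unfolding eventually_at_right_field by (meson less_imp_le)
    qed
    then have "\<forall>c\<in>X. \<forall>\<^sub>F \<eta> in at_right 0. dist c (q + \<eta> *\<^sub>R (j + \<eta> *\<^sub>R u)) \<le> \<rho>"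
      unfolding eventually_at_right_field by meson
    then have "\<forall>\<^sub>F \<eta> in at_right 0. \<forall>c\<in>X. dist c (q + \<eta> *\<^sub>R (j + \<eta> *\<^sub>R u)) \<le> \<rho>"
      using fin by (simp add: eventually_ball_finite)
    then obtain t :: real where t: "t > 0" and
      "\<And>\<eta>. 0 < \<eta> \<Longrightarrow> \<eta> < t \<Longrightarrow> \<forall>c\<in>X. dist c (q + \<eta> *\<^sub>R (j + \<eta> *\<^sub>R u)) \<le> \<rho>"
      unfolding eventually_at_right_field by auto
    from this(2)[of "t / 2"] t have "q + (t / 2) *\<^sub>R (j + (t / 2) *\<^sub>R u) \<in> E"
      by (simp add: E_def)
    then have "inner u (q + (t / 2) *\<^sub>R (j + (t / 2) *\<^sub>R u)) \<le> inner u q"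
      using inner_le_supp[OF compact_E] u(2) by (metis add_right_cancel h_def)
    then show False using j mult_pos_pos[OF t t] u(1) by (simp add: inner_simps norm_eq_1)
  qed
  obtain v where v: "v \<in> arc_normals q" "0 \<le> cross2 u v"
    using side[of "rot u"] by (auto simp: inner_rot inner_commute[of u])
  obtain v' where v': "v' \<in> arc_normals q" "cross2 u v' \<le> 0"
    using side[of "- rot u"] by (auto simp: inner_rot inner_commute[of u])
  define g where "g = q - x\<^sub>0"
  have gu: "0 \<le> inner u g"
    using inner_le_supp[OF compact_E x0_in_E, of u] u(2) by (simp add: h_def g_def inner_diff_right)
  have gv: "0 < inner v g" "0 < inner v' g" using arc_normal_halfplane v v' by (auto simp: g_def)
  \<comment> \<open>The linear relation between three plane vectors; the half-plane fixes the sign of its left-hand coefficient.\<close>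
  have rel: "cross2 v' v *\<^sub>R u = (- cross2 u v') *\<^sub>R v + cross2 u v *\<^sub>R v'"
    by (simp add: coords algebra_simps)
  then have "inner (cross2 v' v *\<^sub>R u) g = inner ((- cross2 u v') *\<^sub>R v + cross2 u v *\<^sub>R v') g"
    by (rule arg_cong)
  then have relg: "cross2 v' v * inner u g = (- cross2 u v') * inner v g + cross2 u v * inner v' g"
    by (simp add: inner_simps)
  consider "cross2 u v = 0" "cross2 u v' = 0" | "0 < cross2 v' v"
  proof (cases "cross2 u v = 0 \<and> cross2 u v' = 0")
    case False
    then have "0 < (- cross2 u v') * inner v g + cross2 u v * inner v' g"
      using v v' gv by (smt (verit) mult_pos_pos mult_nonneg_nonneg)
    then have "0 < cross2 v' v" using relg gu by (smt (verit) mult_nonneg_nonneg mult_nonpos_nonneg)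
    then show ?thesis using that by blast
  qed (use that in blast)
  then show thesis
  proof cases
    case 1
    have nv: "norm v = 1" using v by (simp add: arc_normals_def)
    have uv: "u = inner u v *\<^sub>R v"
    proof -
      have "inner u v *\<^sub>R v - cross2 u v *\<^sub>R rot v = (v $ 1 * v $ 1 + v $ 2 * v $ 2) *\<^sub>R u"
        by (simp add: coords algebra_simps)
      also have "\<dots> = u" using nv by (simp add: norm_eq_1_vec2)
      finally show ?thesis using 1 by simp
    qed
    have "inner u g = inner u v * inner v g" by (subst uv) simp
    then have "0 \<le> inner u v" using gu gv by (simp add: zero_le_mult_iff)
    then show thesis using that[OF v(1) v(1), of "inner u v" 0] uv by simp
  next
    case 2
    have "u = (- cross2 u v' / cross2 v' v) *\<^sub>R v + (cross2 u v / cross2 v' v) *\<^sub>R v'"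
    proof -
      have "u = (1 / cross2 v' v) *\<^sub>R (cross2 v' v *\<^sub>R u)" using 2 by simp
      then show ?thesis unfolding rel by (simp add: scaleR_add_right scaleR_diff_right)
    qed
    then show thesis
      by (rule that[OF v(1) v'(1), rotated 2]) (use 2 v v' in \<open>simp_all add: divide_nonneg_pos divide_nonpos_pos\<close>)
  qed
qed

text \<open>Over the normal cone at \<open>q\<close> the support function of \<open>E\<close> is linear, so, as a function of u1 in
  that cone, \<open>Phi\<close> is a linear function plus the positive constant \<open>s * \<epsilon>\<close> with s = \<open>cross2 u\<^sub>2 u\<^sub>3\<close>. On the
  unit circle such a function with values above \<open>s * \<epsilon>\<close> is strictly concave, hence its minimum over an
  arc is attained only at the end points. Rotating u1 both ways until it
  becomes a generator of the cone or the triangle becomes right-angled gives two such end points, at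
  which the bound is already known.\<close>

lemma wide_step:
  assumes IH: "\<And>a q. a \<in> arc_normals q \<Longrightarrow> nonobtuse a u\<^sub>2 u\<^sub>3 \<Longrightarrow> wide a u\<^sub>2 u\<^sub>3"
    and non: "nonobtuse u\<^sub>1 u\<^sub>2 u\<^sub>3"
  shows "wide u\<^sub>1 u\<^sub>2 u\<^sub>3"
proof -
  have n: "norm u\<^sub>1 = 1" "norm u\<^sub>2 = 1" "norm u\<^sub>3 = 1" using non by (auto simp: nonobtuse_def)
  obtain q where q: "q \<in> E" "supp E u\<^sub>1 = inner u\<^sub>1 q"
    using supp_attained compact_E x0_in_E by blast
  consider "\<not> acute u\<^sub>1 u\<^sub>2 u\<^sub>3" | "u\<^sub>1 \<in> arc_normals q" | "acute u\<^sub>1 u\<^sub>2 u\<^sub>3" "u\<^sub>1 \<notin> arc_normals q" by blast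
  then show ?thesis
  proof cases
    case 1
    then show ?thesis using wide_if_right_angle non by blast
  next
    case 2
    then show ?thesis using IH non by blast
  next
    case 3
    define s where "s = cross2 u\<^sub>2 u\<^sub>3"
    have s0: "0 < s" using acute_nonobtuse_cross_pos non 3 by (simp add: s_def)
    have s1: "s \<le> 1"
    proof (rule power2_le_imp_le)
      show "s\<^sup>2 \<le> 1\<^sup>2"
        using unit_triple_sines(3)[OF n] zero_le_power2[of "inner u\<^sub>2 u\<^sub>3"] unfolding s_def one_power2 by linarith
    qed simp
    have hu: "h u\<^sub>1 = inner u\<^sub>1 q + \<epsilon>" using q(2) by (simp add: h_def)
    \<comment> \<open>The two ends of the arc of admissible normals at q.\<close>
    obtain v v' \<alpha> \<beta> where v: "v \<in> arc_normals q" "v' \<in> arc_normals q" "0 \<le> \<alpha>" "0 \<le> \<beta>"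
      and u: "u\<^sub>1 = \<alpha> *\<^sub>R v + \<beta> *\<^sub>R v'"
      using normal_cone_generators[OF q(1) n(1) hu] by blast
    have nv: "norm v = 1" "norm v' = 1" using v by (auto simp: arc_normals_def)
    have "\<alpha> \<noteq> 0" "\<beta> \<noteq> 0" using u n(1) nv v 3 by auto
    then have pos: "0 < \<alpha>" "0 < \<beta>" using v by auto
    define g where "g = q - x\<^sub>0"
    have gv: "0 < inner v g" "0 < inner v' g" using v arc_normal_halfplane by (auto simp: g_def)
    then have gu: "0 < inner u\<^sub>1 g" using pos by (simp add: u inner_simps add_pos_pos)
    have cu: "inner u\<^sub>1 u\<^sub>2 < 0" "inner u\<^sub>1 u\<^sub>3 < 0" "inner u\<^sub>2 u\<^sub>3 < 0" using 3 by (auto simp: acute_def inner_commute)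
    \<comment> \<open>Here a is the end point reached when rotating towards y; y is expressed through a so that it can be eliminated from the representation of the first normal.\<close>
    have towards: "\<exists>a k m. 0 < k \<and> 0 \<le> m \<and> y = k *\<^sub>R a - m *\<^sub>R u\<^sub>1 \<and> norm a = 1 \<and> inner a u\<^sub>1 < 1
        \<and> h a = inner a q + \<epsilon> \<and> w \<le> Phi a u\<^sub>2 u\<^sub>3" if y: "y \<in> arc_normals q" for y
    proof -
      have ny: "norm y = 1" using y by (simp add: arc_normals_def)
      have gy: "0 < inner y g" using arc_normal_halfplane[OF y] by (simp add: g_def)
      obtain a \<kappa> t where a: "0 < \<kappa>" "0 < t" "t \<le> 1" "a = \<kappa> *\<^sub>R ((1 - t) *\<^sub>R u\<^sub>1 + t *\<^sub>R y)" "norm a = 1"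
        "inner a u\<^sub>2 \<le> 0" "inner a u\<^sub>3 \<le> 0" "a = y \<or> inner a u\<^sub>2 = 0 \<or> inner a u\<^sub>3 = 0"
        by (rule unit_vector_towards[OF ny gu gy cu(1,2)])
      have "y = (1 / (\<kappa> * t)) *\<^sub>R a - ((1 - t) / t) *\<^sub>R u\<^sub>1"
        using a(1,2) by (simp add: a(4) scaleR_add_right)
      moreover have "inner a u\<^sub>1 < 1"
      proof (rule inner_less_1_unit[OF a(5) n(1)])
        show "a \<noteq> u\<^sub>1" using a(8) y 3(2) cu by (metis less_irrefl)
      qed
      moreover have "h a = inner a q + \<epsilon>"
      proof -
        have "inner a x \<le> inner a q" if x: "x \<in> E" for x
        proof -
          have "inner u\<^sub>1 x \<le> inner u\<^sub>1 q" using inner_le_supp[OF compact_E x] q by metis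
          moreover have "inner y x \<le> inner y q"
            using inner_le_supp[OF compact_E x, of y] h_arc_normal[OF y] by (simp add: h_def)
          ultimately have "(1 - t) * inner u\<^sub>1 x + t * inner y x \<le> (1 - t) * inner u\<^sub>1 q + t * inner y q"
            using a by (intro add_mono mult_left_mono) auto
          then show ?thesis using a(1) by (simp add: a(4) inner_simps)
        qed
        then show ?thesis using supp_eqI[OF q(1)] by (simp add: h_def)
      qed
      moreover have "w \<le> Phi a u\<^sub>2 u\<^sub>3"
      proof -
        have non': "nonobtuse a u\<^sub>2 u\<^sub>3"
          using a n cu s0 by (intro nonobtuseI) (auto simp: s_def inner_commute)
        have "wide a u\<^sub>2 u\<^sub>3"
        proof (cases "a = y")
          case True
          then show ?thesis using IH y non' by blast
        next
          case False
          then have "\<not> acute a u\<^sub>2 u\<^sub>3" using a by (auto simp: acute_def inner_commute)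
          then show ?thesis using wide_if_right_angle non' by blast
        qed
        then show ?thesis by (simp add: wide_def)
      qed
      ultimately show ?thesis using a by (intro exI[of _ a] exI[of _ "1 / (\<kappa> * t)"] exI[of _ "(1 - t) / t"]) auto
    qed
    obtain a k m where a: "0 < k" "0 \<le> m" "v = k *\<^sub>R a - m *\<^sub>R u\<^sub>1" "norm a = 1" "inner a u\<^sub>1 < 1"
      "h a = inner a q + \<epsilon>" "w \<le> Phi a u\<^sub>2 u\<^sub>3" using towards[OF v(1)] by blast
    obtain a' k' m' where a': "0 < k'" "0 \<le> m'" "v' = k' *\<^sub>R a' - m' *\<^sub>R u\<^sub>1" "norm a' = 1" "inner a' u\<^sub>1 < 1"
      "h a' = inner a' q + \<epsilon>" "w \<le> Phi a' u\<^sub>2 u\<^sub>3" using towards[OF v(2)] by blast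
    define M where "M = 1 + \<alpha> * m + \<beta> * m'"
    have M: "0 < M" using a a' pos by (simp add: M_def add_pos_nonneg)
    define x where "x = \<alpha> * k / M"
    define x' where "x' = \<beta> * k' / M"
    have xpos: "0 < x" "0 < x'" using a a' pos M by (auto simp: x_def x'_def)
    have "M *\<^sub>R u\<^sub>1 = (\<alpha> * k) *\<^sub>R a + (\<beta> * k') *\<^sub>R a'"
    proof -
      have "u\<^sub>1 = \<alpha> *\<^sub>R (k *\<^sub>R a - m *\<^sub>R u\<^sub>1) + \<beta> *\<^sub>R (k' *\<^sub>R a' - m' *\<^sub>R u\<^sub>1)" using u a(3) a'(3) by simp
      then show ?thesis unfolding M_def by (simp add: algebra_simps)
    qed
    then have "(1 / M) *\<^sub>R (M *\<^sub>R u\<^sub>1) = x *\<^sub>R a + x' *\<^sub>R a'"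
      by (simp only: scaleR_add_right scaleR_scaleR) (simp add: x_def x'_def)
    then have comb: "u\<^sub>1 = x *\<^sub>R a + x' *\<^sub>R a'" using M by simp
    \<comment> \<open>The strict triangle inequality for this combination of unit vectors gives strict concavity.\<close>
    have "1 = x * inner a u\<^sub>1 + x' * inner a' u\<^sub>1"
      using n(1) comb by (metis inner_add_left inner_scaleR_left norm_eq_1)
    also have "\<dots> < x * 1 + x' * 1"
      using xpos a a' by (intro add_strict_mono mult_strict_left_mono) auto
    finally have gt1: "1 < x + x'" by simp
    define l where "l p = s * inner p q + cross2 u\<^sub>3 p * h u\<^sub>2 + cross2 p u\<^sub>2 * h u\<^sub>3" for p
    have Phil: "Phi p u\<^sub>2 u\<^sub>3 = l p + s * \<epsilon>" if "h p = inner p q + \<epsilon>" for p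
      using that by (simp add: Phi_def l_def s_def algebra_simps)
    have "s * \<epsilon> < w"
    proof -
      have "s * \<epsilon> \<le> 1 * \<epsilon>" using s1 eps by (intro mult_right_mono) auto
      then show ?thesis using w_ge eps by linarith
    qed
    then have "1 * (w - s * \<epsilon>) < (x + x') * (w - s * \<epsilon>)" using gt1 by (intro mult_strict_right_mono) auto
    also have "\<dots> = x * (w - s * \<epsilon>) + x' * (w - s * \<epsilon>)" by (simp add: algebra_simps)
    also have "\<dots> \<le> x * l a + x' * l a'"
      using xpos Phil[OF a(6)] Phil[OF a'(6)] a(7) a'(7) by (intro add_mono mult_left_mono) auto
    also have "\<dots> = l (x *\<^sub>R a + x' *\<^sub>R a')"
      by (simp add: l_def inner_simps cross2_def algebra_simps)
    also have "\<dots> = l u\<^sub>1" using comb by simp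
    finally have "w < Phi u\<^sub>1 u\<^sub>2 u\<^sub>3" using Phil[of u\<^sub>1] q(2) by (simp add: h_def)
    then show ?thesis by (simp add: wide_def)
  qed
qed

text \<open>The three normals are replaced by generators of their normal cones one after the other.\<close>

theorem nonobtuse_wide:
  assumes "nonobtuse u\<^sub>1 u\<^sub>2 u\<^sub>3"
  shows "wide u\<^sub>1 u\<^sub>2 u\<^sub>3"
proof -
  have 1: "wide a b c" if "nonobtuse a b c" "b \<in> arc_normals q" "c \<in> arc_normals q'" for a b c q q'
    using wide_step[OF wide_if_arc_normals[OF _ _ that(2,3)] that(1)] by simp
  have 2: "wide b c a" if "nonobtuse b c a" "c \<in> arc_normals q" for a b c q
  proof (rule wide_step[OF _ that(1)])
    fix x q' assume x: "x \<in> arc_normals q'" "nonobtuse x c a"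
    show "wide x c a"
      by (rule wide_rotate[OF 1[OF nonobtuse_rotate[OF nonobtuse_rotate[OF x(2)]] x(1) that(2)]])
  qed
  show ?thesis
  proof (rule wide_step[OF _ assms])
    fix x q assume x: "x \<in> arc_normals q" "nonobtuse x u\<^sub>2 u\<^sub>3"
    show "wide x u\<^sub>2 u\<^sub>3"
      by (rule wide_rotate[OF 2[OF nonobtuse_rotate[OF nonobtuse_rotate[OF x(2)]] x(1)]])
  qed
qed

text \<open>An acute triangle of supporting lines is compared through its orthic triangle, any other through its
  altitude from the largest angle.\<close>

lemma triangle_perimeter_gt:
  assumes n: "norm u\<^sub>1 = 1" "norm u\<^sub>2 = 1" "norm u\<^sub>3 = 1"
    and s: "0 < cross2 u\<^sub>2 u\<^sub>3" "0 < cross2 u\<^sub>3 u\<^sub>1" "0 < cross2 u\<^sub>1 u\<^sub>2"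
    and p: "inner u\<^sub>1 p\<^sub>1 = h u\<^sub>1" "inner u\<^sub>2 p\<^sub>2 = h u\<^sub>2" "inner u\<^sub>3 p\<^sub>3 = h u\<^sub>3"
  shows "2 * w < dist p\<^sub>1 p\<^sub>2 + dist p\<^sub>2 p\<^sub>3 + dist p\<^sub>3 p\<^sub>1"
proof -
  have obtuse: "2 * w < dist p\<^sub>1 p\<^sub>2 + dist p\<^sub>2 p\<^sub>3 + dist p\<^sub>3 p\<^sub>1"
    if n: "norm u\<^sub>1 = 1" "norm u\<^sub>2 = 1" "norm u\<^sub>3 = 1"
    and s: "0 < cross2 u\<^sub>2 u\<^sub>3" "0 < cross2 u\<^sub>3 u\<^sub>1" "0 < cross2 u\<^sub>1 u\<^sub>2"
    and p: "inner u\<^sub>1 p\<^sub>1 = h u\<^sub>1" "inner u\<^sub>2 p\<^sub>2 = h u\<^sub>2" "inner u\<^sub>3 p\<^sub>3 = h u\<^sub>3"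
    and o: "0 \<le> inner u\<^sub>2 u\<^sub>3" for u\<^sub>1 u\<^sub>2 u\<^sub>3 p\<^sub>1 p\<^sub>2 p\<^sub>3
  proof -
    define T where "T = dist p\<^sub>1 p\<^sub>2 + dist p\<^sub>2 p\<^sub>3 + dist p\<^sub>3 p\<^sub>1"
    have less1: "- inner a b < 1" if "norm a = 1" "norm b = 1" "cross2 a b \<noteq> 0" for a b
    proof -
      have "a \<noteq> - b" using that by (auto simp: cross2_def)
      then show ?thesis using inner_less_1_unit[of a "- b"] that by simp
    qed
    have "cross2 u\<^sub>2 u\<^sub>3 = cross2 u\<^sub>3 u\<^sub>1 * - inner u\<^sub>1 u\<^sub>2 + cross2 u\<^sub>1 u\<^sub>2 * - inner u\<^sub>3 u\<^sub>1"
      using unit_triple_sines(1)[OF n] .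
    also have "\<dots> < cross2 u\<^sub>3 u\<^sub>1 * 1 + cross2 u\<^sub>1 u\<^sub>2 * 1"
      using less1[OF n(1,2)] less1[OF n(3,1)] s by (intro add_strict_mono mult_strict_left_mono) auto
    finally have "0 < \<epsilon> * (cross2 u\<^sub>3 u\<^sub>1 + cross2 u\<^sub>1 u\<^sub>2 - cross2 u\<^sub>2 u\<^sub>3)" using eps by simp
    then have "cross2 u\<^sub>2 u\<^sub>3 * w < Phi u\<^sub>1 u\<^sub>2 u\<^sub>3"
      using Phi_ge_altitude[OF n(1), of u\<^sub>2 u\<^sub>3] s by simp
    moreover have "2 * Phi u\<^sub>1 u\<^sub>2 u\<^sub>3 \<le> cross2 u\<^sub>2 u\<^sub>3 * T"
      using perimeter_ge_altitude[OF n s o, of p\<^sub>1 p\<^sub>2 p\<^sub>3] p by (simp add: Phi_def T_def)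
    ultimately have "cross2 u\<^sub>2 u\<^sub>3 * (2 * w) < cross2 u\<^sub>2 u\<^sub>3 * T" by linarith
    then show ?thesis using s(1) by (simp add: T_def)
  qed
  consider "0 \<le> inner u\<^sub>2 u\<^sub>3" | "0 \<le> inner u\<^sub>3 u\<^sub>1" | "0 \<le> inner u\<^sub>1 u\<^sub>2" | "acute u\<^sub>1 u\<^sub>2 u\<^sub>3"
    by (force simp: acute_def)
  then show ?thesis
  proof cases
    case 1
    then show ?thesis using obtuse[OF n s p] by simp
  next
    case 2
    then show ?thesis using obtuse[OF n(2,3,1) s(2,3,1) p(2,3,1)] by simp
  next
    case 3
    then show ?thesis using obtuse[OF n(3,1,2) s(3,1,2) p(3,1,2)] by simp
  next
    case 4
    then have "nonobtuse u\<^sub>1 u\<^sub>2 u\<^sub>3" using n s by (simp add: nonobtuse_def acute_def)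
    then have "w < Phi u\<^sub>1 u\<^sub>2 u\<^sub>3" using nonobtuse_wide 4 by (simp add: wide_def)
    then show ?thesis using perimeter_ge_orthic[OF n, of p\<^sub>1 p\<^sub>2 p\<^sub>3] p by (simp add: Phi_def)
  qed
qed

end

section \<open>Double normals\<close>

text \<open>The difference body of \<open>K\<close> has support function v \<mapsto> width of \<open>K\<close> in direction v. Its boundary point
  \<open>d\<close> nearest to the origin is orthogonal to a supporting line there, because the ball of radius
  \<open>norm d\<close> around the origin lies inside. Writing \<open>d\<close> as a difference of two points of \<open>K\<close> gives a
  chord that is normal to \<open>K\<close> at both ends and whose length is the minimal width.\<close>

lemma double_normal:
  fixes K :: "'a :: euclidean_space set"
  assumes K: "compact K" "convex K" "interior K \<noteq> {}"
  obtains p q u w where "p \<in> K" "q \<in> K" "norm u = 1" "0 < w" "p - q = w *\<^sub>R u"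
    "\<And>x. x \<in> K \<Longrightarrow> inner u x \<le> inner u p" "\<And>x. x \<in> K \<Longrightarrow> inner u q \<le> inner u x"
    "\<And>v. norm v = 1 \<Longrightarrow> w \<le> supp K v + supp K (- v)"
proof -
  define B where "B = (\<Union>x\<in>K. \<Union>y\<in>K. {x - y})"
  have BE: "B = {x - y |x y. x \<in> K \<and> y \<in> K}" by (auto simp: B_def)
  have cB: "compact B" unfolding BE by (rule compact_differences[OF K(1) K(1)])
  have vB: "convex B" unfolding B_def by (rule convex_differences[OF K(2) K(2)])
  obtain x e where e: "0 < e" "ball x e \<subseteq> K" using K(3) by (metis ex_in_conv mem_interior)
  have "ball 0 e \<subseteq> B"
  proof
    fix z :: 'a assume "z \<in> ball 0 e"
    then have "x + z \<in> K" "x \<in> K" using e by (auto simp: dist_norm)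
    then show "z \<in> B" unfolding BE by force
  qed
  then have int0: "0 \<in> interior B" using e(1) by (auto simp: mem_interior)
  have zB: "0 \<in> B" using int0 interior_subset by blast
  have "frontier B \<noteq> {}"
    using cB zB by (metis compact_imp_bounded empty_iff frontier_eq_empty not_bounded_UNIV)
  then obtain d where d: "d \<in> frontier B" "\<And>y. y \<in> frontier B \<Longrightarrow> dist 0 d \<le> dist 0 y"
    using distance_attains_inf[of "frontier B" 0] by auto
  have dB: "d \<in> B" using d(1) cB by (metis compact_imp_closed frontier_subset_closed subsetD)
  have "d \<noteq> 0" using d(1) int0 by (auto simp: frontier_def)
  then have nd: "0 < norm d" by simp
  have small: "z \<in> B" if z: "norm z < norm d" for z
  proof (rule ccontr)
    assume "z \<notin> B"
    then have "closed_segment 0 z \<inter> frontier B \<noteq> {}"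
      using zB by (intro connected_Int_frontier) auto
    then obtain y where "y \<in> closed_segment 0 z" "y \<in> frontier B" by auto
    then have "norm y \<le> norm z" "norm d \<le> norm y"
      using d(2)[of y] segment_bound(1)[of y 0 z] by auto
    then show False using z by simp
  qed
  have "d \<in> closure B" "d \<notin> rel_interior B"
    using d(1) int0 rel_interior_nonempty_interior[of B] by (auto simp: frontier_def)
  then obtain a where a: "a \<noteq> 0" "\<And>y. y \<in> closure B \<Longrightarrow> inner a d \<le> inner a y"
    using supporting_hyperplane_relative_frontier[OF vB] by metis
  define u where "u = - sgn a"
  have nu: "norm u = 1" using a by (simp add: u_def norm_sgn)
  have ud: "inner u y \<le> inner u d" if "y \<in> B" for y
    using a(2)[of y] closure_subset[of B] that a(1) by (auto simp: u_def sgn_div_norm divide_right_mono)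
  have "norm d \<le> inner u d"
  proof (rule field_le_mult_one_interval)
    fix t :: real assume "0 < t" "t < 1"
    then have "(t * norm d) *\<^sub>R u \<in> B" using nu nd by (intro small) simp
    from ud[OF this] show "t * norm d \<le> inner u d" using nu by (simp add: norm_eq_1)
  qed
  moreover have "inner u d \<le> norm d" using norm_cauchy_schwarz[of u d] nu by simp
  ultimately have "inner u d = norm u * norm d" using nu by simp
  then have "norm u *\<^sub>R d = norm d *\<^sub>R u" by (rule norm_cauchy_schwarz_eq[THEN iffD1])
  then have du: "d = norm d *\<^sub>R u" using nu by simp
  obtain p q where pq: "p \<in> K" "q \<in> K" "d = p - q" using dB by (auto simp: BE)
  have diff: "inner u (x - y) \<le> inner u (p - q)" if "x \<in> K" "y \<in> K" for x y
    using ud[of "x - y"] that pq by (auto simp: BE)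
  show thesis
  proof (rule that[of p q u "norm d"])
    show "p - q = norm d *\<^sub>R u" using du pq by simp
    show "inner u x \<le> inner u p" if "x \<in> K" for x using diff[OF that pq(2)] by (simp add: inner_diff_right)
    show "inner u q \<le> inner u x" if "x \<in> K" for x using diff[OF pq(1) that] by (simp add: inner_diff_right)
    fix v :: 'a assume v: "norm v = 1"
    show "norm d \<le> supp K v + supp K (- v)"
    proof (rule field_le_mult_one_interval)
      fix t :: real assume "0 < t" "t < 1"
      then have "(t * norm d) *\<^sub>R v \<in> B" using v nd by (intro small) simp
      then obtain x y where xy: "x \<in> K" "y \<in> K" "(t * norm d) *\<^sub>R v = x - y" by (auto simp: BE)
      then have "t * norm d = inner v (x - y)" using v by (metis inner_scaleR_right norm_eq_1 mult.right_neutral)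
      then show "t * norm d \<le> supp K v + supp K (- v)"
        using inner_le_supp[OF K(1) xy(1), of v] inner_le_supp[OF K(1) xy(2), of "- v"] by (simp add: inner_diff_right)
    qed
  qed (use pq nu nd in auto)
qed

section \<open>Angles and bisectors\<close>

lemma vec_angle_arg_bounds: "\<bar>inner a b / (norm a * norm b)\<bar> \<le> 1"
  using Cauchy_Schwarz_ineq2[of a b]
  by (cases "a = 0 \<or> b = 0") (auto simp: abs_mult divide_le_eq)

lemma vec_angle_self: "a \<noteq> 0 \<Longrightarrow> vec_angle a a = 0"
  by (simp add: vec_angle_def norm_eq_sqrt_inner)

lemma vec_angle_zeroD:
  assumes "vec_angle b a = 0" "a \<noteq> 0"
  shows "\<exists>k. b = k *\<^sub>R a"
proof (cases "b = 0")
  case True then show ?thesis by (metis scaleR_zero_left)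
next
  case False
  have "cos (vec_angle b a) = inner b a / (norm b * norm a)"
    unfolding vec_angle_def using vec_angle_arg_bounds by (rule cos_arccos_abs)
  then have "inner b a = norm b * norm a" using assms False by (simp add: field_simps)
  then have "norm b *\<^sub>R a = norm a *\<^sub>R b" by (simp add: norm_cauchy_schwarz_eq)
  then have "(1 / norm a) *\<^sub>R norm b *\<^sub>R a = b" using assms by simp
  then show ?thesis by (metis scaleR_scaleR)
qed

lemma vec_angle_commute: "vec_angle a b = vec_angle b a"
  by (simp add: vec_angle_def inner_commute mult.commute)

text \<open>The sum of the unit vectors along the two sides points along the inner bisector.\<close>

lemma half_angle:
  assumes "a \<noteq> 0" "b \<noteq> 0" "vec_angle a b \<noteq> pi"
  shows "sgn a + sgn b \<noteq> 0" "vec_angle (sgn a + sgn b) a = vec_angle a b / 2"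
proof -
  define t where "t = inner (sgn a) (sgn b)"
  define \<theta> where "\<theta> = vec_angle a b"
  have ta: "t = inner a b / (norm a * norm b)"
    by (simp add: t_def sgn_div_norm field_simps)
  have tb: "\<bar>t\<bar> \<le> 1" unfolding ta by (rule vec_angle_arg_bounds)
  have \<theta>: "\<theta> = arccos t" by (simp add: \<theta>_def ta vec_angle_def)
  have \<theta>b: "0 \<le> \<theta>" "\<theta> \<le> pi" using tb by (auto simp: \<theta> intro: arccos_lbound arccos_ubound)
  have "t \<noteq> - 1" using assms(3) \<theta> by (auto simp: \<theta>_def)
  then have t1: "0 < 1 + t" using tb by auto
  have n: "norm (sgn a) = 1" "norm (sgn b) = 1" using assms by (auto simp: norm_sgn)
  define N where "N = norm (sgn a + sgn b)"
  have N2: "N\<^sup>2 = 2 * (1 + t)"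
    using n by (simp add: N_def power2_norm_eq_inner inner_simps norm_eq_1 t_def inner_commute)
  then have N: "0 < N" using t1 by (metis N_def mult_pos_pos norm_ge_zero less_eq_real_def zero_less_numeral less_irrefl zero_power2)
  then show "sgn a + sgn b \<noteq> 0" by (auto simp: N_def)
  have "inner (sgn a + sgn b) a = norm a * inner (sgn a + sgn b) (sgn a)"
    using assms by (simp add: sgn_div_norm)
  also have "inner (sgn a + sgn b) (sgn a) = 1 + t"
    using n by (simp add: inner_simps norm_eq_1 t_def inner_commute)
  finally have "inner (sgn a + sgn b) a / (N * norm a) = (1 + t) / N"
    using assms by simp
  also have "\<dots> = cos (\<theta> / 2)"
  proof (rule power2_eq_imp_eq)
    have "cos \<theta> = t" using tb by (simp add: \<theta> cos_arccos_abs)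
    then have "2 * (cos (\<theta> / 2))\<^sup>2 = 1 + t" using cos_double_cos[of "\<theta> / 2"] by simp
    moreover have "((1 + t) / N)\<^sup>2 = (1 + t) / 2"
      unfolding power_divide N2 using t1 by (simp add: power2_eq_square field_simps)
    ultimately show "((1 + t) / N)\<^sup>2 = (cos (\<theta> / 2))\<^sup>2" by simp
    show "0 \<le> cos (\<theta> / 2)" using \<theta>b by (intro cos_ge_zero) auto
  qed (use t1 N in auto)
  finally show "vec_angle (sgn a + sgn b) a = vec_angle a b / 2"
    using \<theta>b unfolding vec_angle_def[of "sgn a + sgn b" a] N_def[symmetric] by (simp add: \<theta>_def arccos_cos)
qed

section \<open>Billiard trajectories\<close>

lemma supported_point_in_frontier:
  fixes K :: "'a :: real_inner set"
  assumes "x \<in> K" "norm u = 1" "\<And>y. y \<in> K \<Longrightarrow> inner u y \<le> inner u x"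
  shows "x \<in> frontier K"
proof -
  have "x \<notin> interior K"
  proof
    assume "x \<in> interior K"
    then obtain e where e: "0 < e" "ball x e \<subseteq> K" by (auto simp: mem_interior)
    then have "x + (e / 2) *\<^sub>R u \<in> K" using assms(2) by (auto simp: dist_norm)
    then show False using assms(3)[of "x + (e / 2) *\<^sub>R u"] e assms(2) by (simp add: inner_simps norm_eq_1)
  qed
  then show ?thesis using assms(1) closure_subset by (auto simp: frontier_def)
qed

text \<open>At either end the angle is 0 and the bisector is the chord itself.\<close>

lemma double_normal_is_trajectory:
  assumes pq: "p \<in> K" "q \<in> K" "norm u = 1" "0 < w" "p - q = w *\<^sub>R u"
    and max: "\<And>x. x \<in> K \<Longrightarrow> inner u x \<le> inner u p" and min: "\<And>x. x \<in> K \<Longrightarrow> inner u q \<le> inner u x"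
  shows "generalized_billiard_trajectory K [p, q]" "path_len [p, q] = 2 * w"
proof -
  have ne: "p \<noteq> q" using pq by auto
  have d: "dist p q = w" using pq by (simp add: dist_norm)
  show "path_len [p, q] = 2 * w"
    by (simp add: path_len_def next_vertex_def d dist_commute lessThan_Suc numeral_2_eq_2)
  have vertex: "\<exists>L. supporting_line K L \<and> x \<in> L \<and>
      (\<forall>z \<in> inner_angle_bisector y x y. \<forall>y \<in> L. inner (z - x) (y - x) = 0)"
    if x: "x \<in> K" "x \<noteq> y" "y - x = k *\<^sub>R v" "norm v = 1" "\<And>z. z \<in> K \<Longrightarrow> inner v z \<le> inner v x" for x y k v
  proof (intro exI conjI ballI)
    show "supporting_line K {z. inner v z = inner v x}"
      unfolding supporting_line_def using x by (intro exI[of _ v] exI[of _ "inner v x"]) force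
    show "x \<in> {z. inner v z = inner v x}" by simp
    fix z y' assume z: "z \<in> inner_angle_bisector y x y" and y': "y' \<in> {z. inner v z = inner v x}"
    have "\<exists>c. z - x = c *\<^sub>R (y - x)"
    proof (cases "z = x")
      case False
      then have "vec_angle (z - x) (y - x) = 0"
        using z x(2) by (simp add: inner_angle_bisector_def vec_angle_self)
      then show ?thesis using vec_angle_zeroD x(2) by simp
    qed (auto intro: exI[of _ 0])
    then obtain c where "z - x = (c * k) *\<^sub>R v" using x(3) by auto
    then show "inner (z - x) (y' - x) = 0" using y' by (simp add: inner_diff_right)
  qed
  have vp: "\<exists>L. supporting_line K L \<and> p \<in> L \<and>
      (\<forall>z \<in> inner_angle_bisector q p q. \<forall>y \<in> L. inner (z - p) (y - p) = 0)"
    using vertex[of p q "- w" u] pq ne max by (simp add: algebra_simps)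
  have vq: "\<exists>L. supporting_line K L \<and> q \<in> L \<and>
      (\<forall>z \<in> inner_angle_bisector p q p. \<forall>y \<in> L. inner (z - q) (y - q) = 0)"
    using vertex[of q p "- w" "- u"] pq ne min by simp
  have "p \<in> frontier K" "q \<in> frontier K"
    using supported_point_in_frontier[of p K u] supported_point_in_frontier[of q K "- u"] pq max min by auto
  then show "generalized_billiard_trajectory K [p, q]"
    using vp vq ne
    by (auto simp: generalized_billiard_trajectory_def closed_polygonal_path_def next_vertex_def
        prev_vertex_def vec_angle_self less_2_cases_iff numeral_2_eq_2 less_Suc_eq)
qed

text \<open>The sum of the unit vectors from the vertex towards its neighbours spans the bisector, which is
  orthogonal to a supporting line. Both neighbours lie in \<open>K\<close>, so the sum points to the inner side of
  that line.\<close>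

lemma trajectory_normal:
  assumes K: "closed K" and traj: "generalized_billiard_trajectory K ps" and i: "i < length ps"
  obtains u \<mu> where "norm u = 1" "0 < \<mu>" "\<And>x. x \<in> K \<Longrightarrow> inner u x \<le> inner u (ps ! i)"
    "sgn (ps ! i - prev_vertex ps i) + sgn (ps ! i - next_vertex ps i) = \<mu> *\<^sub>R u"
proof -
  define p a b where "p = ps ! i" "a = prev_vertex ps i" "b = next_vertex ps i"
  note pab = this
  have cpp: "closed_polygonal_path ps" and fr: "set ps \<subseteq> frontier K"
    using traj by (auto simp: generalized_billiard_trajectory_def)
  have n: "length ps \<ge> 2" using cpp by (simp add: closed_polygonal_path_def)
  have pb: "p \<noteq> b" and ang: "vec_angle (a - p) (b - p) \<noteq> pi"
    using cpp i by (auto simp: closed_polygonal_path_def pab)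
  have pa: "a \<noteq> p"
  proof -
    define j where "j = (i + length ps - 1) mod length ps"
    have j: "j < length ps" unfolding j_def using n by (intro mod_less_divisor) linarith
    have "(j + 1) mod length ps = (i + length ps - 1 + 1) mod length ps"
      unfolding j_def by (rule mod_add_left_eq)
    also have "i + length ps - 1 + 1 = i + length ps" using n by linarith
    also have "(i + length ps) mod length ps = i" using i by simp
    finally have "next_vertex ps j = p" by (simp add: next_vertex_def pab)
    moreover have "a = ps ! j" by (simp add: pab prev_vertex_def j_def)
    ultimately show ?thesis using cpp j by (auto simp: closed_polygonal_path_def)
  qed
  have "\<forall>j<length ps. ps ! j \<in> K" using fr K frontier_subset_closed by (metis nth_mem subsetD)
  moreover have "m mod length ps < length ps" for m using n by (intro mod_less_divisor) linarith
  ultimately have aK: "a \<in> K" "b \<in> K" by (auto simp: pab prev_vertex_def next_vertex_def)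
  define s where "s = sgn (a - p) + sgn (b - p)"
  have s: "s \<noteq> 0" "vec_angle s (a - p) = vec_angle (a - p) (b - p) / 2"
    unfolding s_def using half_angle[of "a - p" "b - p"] pa pb ang by auto
  have "vec_angle s (b - p) = vec_angle (a - p) (b - p) / 2"
    unfolding s_def using half_angle(2)[of "b - p" "a - p"] pa pb ang
    by (metis add.commute eq_iff_diff_eq_0 vec_angle_commute)
  then have bis: "p + s \<in> inner_angle_bisector a p b" using s by (simp add: inner_angle_bisector_def)
  obtain L where L: "supporting_line K L" "p \<in> L"
    "\<forall>x \<in> inner_angle_bisector a p b. \<forall>y \<in> L. inner (x - p) (y - p) = 0"
    using traj i unfolding generalized_billiard_trajectory_def pab by blast
  obtain v \<beta> where v: "v \<noteq> 0" "L = {x. inner v x = \<beta>}" "\<forall>x\<in>K. inner v x \<le> \<beta>"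
    using L(1) by (auto simp: supporting_line_def)
  have vp: "inner v p = \<beta>" using L v by auto
  have "inner v (rot v) = 0" by (metis cross2_self inner_commute inner_rot)
  then \<comment> \<open>A second point of the line, which tests the orthogonality of the bisector.\<close>
 have "p + rot v \<in> L" using vp v(2) by (simp add: inner_add_right)
  then have sv: "inner s (rot v) = 0" using L(3) bis by force
  define u where "u = sgn v"
  have nu: "norm u = 1" using v by (simp add: u_def norm_sgn)
  have umax: "inner u x \<le> inner u p" if "x \<in> K" for x
    using v that vp by (auto simp: u_def sgn_div_norm divide_right_mono)
  have "s = inner u s *\<^sub>R u + cross2 u s *\<^sub>R rot u"
  proof -
    have "inner u s *\<^sub>R u + cross2 u s *\<^sub>R rot u = (u $ 1 * u $ 1 + u $ 2 * u $ 2) *\<^sub>R s"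
      by (simp add: coords algebra_simps)
    then show ?thesis using nu by (simp add: norm_eq_1_vec2)
  qed
  moreover have "cross2 u s = 0"
  proof -
    have "cross2 v s = 0" using sv by (metis inner_rot inner_commute)
    then show ?thesis by (simp add: u_def sgn_div_norm cross2_def algebra_simps)
  qed
  ultimately have su: "s = inner u s *\<^sub>R u" by simp
  have "inner u (sgn (a - p)) \<le> 0" "inner u (sgn (b - p)) \<le> 0"
    using umax[OF aK(1)] umax[OF aK(2)]
    by (auto simp: sgn_div_norm inner_diff_right mult_nonneg_nonpos divide_nonpos_nonneg)
  then have "inner u s \<le> 0" by (simp add: s_def inner_add_right)
  moreover have "inner u s \<noteq> 0" using su s(1) by auto
  ultimately have neg: "0 < - inner u s" by simp
  have "sgn (p - a) + sgn (p - b) = - s"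
    by (simp add: s_def sgn_minus[symmetric])
  also have "\<dots> = (- inner u s) *\<^sub>R u" using su by simp
  finally show thesis using that[OF nu neg] umax by (simp add: pab)
qed

section \<open>Lengths of closed paths\<close>

lemma sum_periodic:
  fixes g :: "nat \<Rightarrow> 'a :: ab_group_add"
  assumes "\<And>k. g (k + n) = g k"
  shows "(\<Sum>k=i..<i+n. g k) = (\<Sum>k<n. g k)"
proof (induction i)
  case 0
  then show ?case by (simp add: atLeast0LessThan)
next
  case (Suc i)
  have "g i + (\<Sum>k=Suc i..<Suc i+n. g k) = (\<Sum>k=i..<Suc (i+n). g k)"
    using sum.atLeast_Suc_lessThan[of i "Suc (i + n)" g] by simp
  also have "\<dots> = (\<Sum>k=i..<i+n. g k) + g (i + n)" by (rule sum.atLeastLessThan_Suc) simp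
  also have "g (i + n) = g i" by (rule assms)
  finally show ?case unfolding Suc.IH by (simp only: add.commute add_left_cancel)
qed

lemma dist_le_path:
  fixes f :: "nat \<Rightarrow> 'a :: metric_space"
  shows "i \<le> j \<Longrightarrow> dist (f i) (f j) \<le> (\<Sum>k=i..<j. dist (f k) (f (Suc k)))"
proof (induction j rule: dec_induct)
  case (step j)
  then show ?case using dist_triangle[of "f i" "f (Suc j)" "f j"] by simp
qed simp

lemma dist_less_path:
  fixes f :: "nat \<Rightarrow> 'a :: metric_space"
  assumes "Suc (Suc i) \<le> j"
    and "dist (f i) (f (Suc (Suc i))) < dist (f i) (f (Suc i)) + dist (f (Suc i)) (f (Suc (Suc i)))"
  shows "dist (f i) (f j) < (\<Sum>k=i..<j. dist (f k) (f (Suc k)))"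
proof -
  have "(\<Sum>k=i..<j. dist (f k) (f (Suc k))) = dist (f i) (f (Suc i)) + dist (f (Suc i)) (f (Suc (Suc i)))
      + (\<Sum>k=Suc (Suc i)..<j. dist (f k) (f (Suc k)))"
    using assms(1) by (simp add: sum.atLeast_Suc_lessThan)
  then show ?thesis
    using assms dist_le_path[OF assms(1), of f] dist_triangle[of "f i" "f j" "f (Suc (Suc i))"] by linarith
qed

lemma strict_triangle_at_vertex:
  assumes "a \<noteq> p" "b \<noteq> p" "vec_angle (a - p) (b - p) \<noteq> pi"
  shows "dist a b < dist a p + dist p b"
proof (rule ccontr)
  assume "\<not> ?thesis"
  then have "dist a b = dist a p + dist p b" using dist_triangle[of a b p] by simp
  then have "norm ((a - p) - (b - p)) = norm (a - p) + norm (b - p)"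
    by (simp add: dist_norm norm_minus_commute)
  then have "(norm ((a - p) - (b - p)))\<^sup>2 = (norm (a - p) + norm (b - p))\<^sup>2" by simp
  moreover have "(norm ((a - p) - (b - p)))\<^sup>2
      = (norm (a - p))\<^sup>2 + (norm (b - p))\<^sup>2 - 2 * inner (a - p) (b - p)"
    unfolding power2_norm_eq_inner by (simp add: inner_diff inner_commute)
  ultimately have "inner (a - p) (b - p) = - (norm (a - p) * norm (b - p))"
    by (simp add: power2_sum)
  then have "vec_angle (a - p) (b - p) = pi" using assms by (simp add: vec_angle_def)
  then show False using assms by simp
qed

text \<open>Reading the vertices as an \<open>n\<close>-periodic sequence \<open>f\<close> turns arcs of the cyclic path into intervals of
  indices.\<close>

locale cyclic_path =
  fixes ps :: "(real ^ 2) list"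
  assumes path: "closed_polygonal_path ps"
begin

definition "n = length ps"
definition "f k = ps ! (k mod n)"

lemma n_ge_2: "n \<ge> 2" using path by (simp add: closed_polygonal_path_def n_def)

lemma f_periodic [simp]: "f (k + n) = f k" by (simp add: f_def)

lemma f_nth: "i < n \<Longrightarrow> f i = ps ! i" by (simp add: f_def)

lemma next_f: "next_vertex ps (k mod n) = f (Suc k)"
  by (simp add: next_vertex_def f_def n_def[symmetric] mod_Suc_eq)

lemma prev_f: "prev_vertex ps (k mod n) = f (k + n - 1)"
proof -
  have "(k mod n + (n - 1)) mod n = (k + (n - 1)) mod n" by (rule mod_add_left_eq)
  then show ?thesis using n_ge_2 by (simp add: prev_vertex_def f_def n_def[symmetric])
qed

lemma path_len_f: "path_len ps = (\<Sum>k=i..<i+n. dist (f k) (f (Suc k)))"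
proof -
  have per: "dist (f (k + n)) (f (Suc (k + n))) = dist (f k) (f (Suc k))" for k
    using f_periodic[of "Suc k"] by simp
  have "path_len ps = (\<Sum>k<n. dist (f k) (f (Suc k)))"
    unfolding path_len_def n_def[symmetric]
  proof (intro sum.cong refl)
    fix x assume "x \<in> {..<n}"
    then show "dist (ps ! x) (next_vertex ps x) = dist (f x) (f (Suc x))"
      using next_f[of x] by (simp add: f_nth)
  qed
  then show ?thesis using sum_periodic[of "\<lambda>k. dist (f k) (f (Suc k))" n i, OF per] by simp
qed

lemma f_consecutive: "f k \<noteq> f (Suc k)"
proof -
  have "k mod n < n" using n_ge_2 by (intro mod_less_divisor) simp
  then show ?thesis using path next_f[of k] by (auto simp: closed_polygonal_path_def n_def f_def)
qed

lemma strict_triangle_f: "dist (f k) (f (Suc (Suc k))) < dist (f k) (f (Suc k)) + dist (f (Suc k)) (f (Suc (Suc k)))"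
proof -
  have "Suc k mod n < n" using n_ge_2 by (intro mod_less_divisor) simp
  then have "vec_angle (prev_vertex ps (Suc k mod n) - f (Suc k)) (next_vertex ps (Suc k mod n) - f (Suc k)) \<noteq> pi"
    using path by (auto simp: closed_polygonal_path_def n_def f_def)
  then have "vec_angle (f k - f (Suc k)) (f (Suc (Suc k)) - f (Suc k)) \<noteq> pi"
    unfolding prev_f next_f by simp
  then show ?thesis using f_consecutive[of k] f_consecutive[of "Suc k"] by (intro strict_triangle_at_vertex) auto
qed

lemma path_len_ge_triangle:
  assumes "i < n" "j < n" "k < n"
  shows "dist (f i) (f j) + dist (f j) (f k) + dist (f k) (f i) \<le> path_len ps"
proof -
  have sorted: "dist (f i) (f j) + dist (f j) (f k) + dist (f k) (f i) \<le> path_len ps"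
    if "i \<le> j" "j \<le> k" "k < n" for i j k
  proof -
    have "path_len ps = (\<Sum>k=i..<j. dist (f k) (f (Suc k))) + (\<Sum>k=j..<k. dist (f k) (f (Suc k)))
        + (\<Sum>k=k..<i+n. dist (f k) (f (Suc k)))"
      using that by (simp add: path_len_f[of i] sum.atLeastLessThan_concat)
    then show ?thesis
      using dist_le_path[OF that(1), of f] dist_le_path[OF that(2), of f] dist_le_path[of k "i + n" f] that by simp
  qed
  consider "i \<le> j" "j \<le> k" | "i \<le> k" "k \<le> j" | "j \<le> i" "i \<le> k" | "j \<le> k" "k \<le> i" | "k \<le> i" "i \<le> j" | "k \<le> j" "j \<le> i"
    by linarith
  then show ?thesis
    using assms sorted[of i j k] sorted[of i k j] sorted[of j i k] sorted[of j k i] sorted[of k i j] sorted[of k j i]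
    by cases (simp_all add: dist_commute add.commute add.left_commute)
qed

text \<open>Two vertices divide the path into two arcs, each at least as long as the chord. With at least three
  vertices one of the arcs has a vertex in its interior, where the path does not go straight on.\<close>

lemma path_len_gt_chord:
  assumes "n \<ge> 3" "i < n" "j < n" "i \<noteq> j"
  shows "2 * dist (f i) (f j) < path_len ps"
proof -
  have ordered: "2 * dist (f i) (f j) < path_len ps" if "i < j" "j < n" for i j
  proof -
    have len: "path_len ps = (\<Sum>k=i..<j. dist (f k) (f (Suc k))) + (\<Sum>k=j..<i+n. dist (f k) (f (Suc k)))"
      using that by (simp add: path_len_f[of i] sum.atLeastLessThan_concat)
    have le: "dist (f i) (f j) \<le> (\<Sum>k=i..<j. dist (f k) (f (Suc k)))"
      "dist (f j) (f i) \<le> (\<Sum>k=j..<i+n. dist (f k) (f (Suc k)))"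
      using dist_le_path[of i j f] dist_le_path[of j "i + n" f] that by auto
    \<comment> \<open>One of the two arcs has at least two sides.\<close>
    consider "Suc (Suc i) \<le> j" | "Suc (Suc j) \<le> i + n" using that assms(1) by linarith
    then show ?thesis
    proof cases
      case 1
      then show ?thesis using dist_less_path[where f = f, OF 1 strict_triangle_f] len le by (simp add: dist_commute)
    next
      case 2
      then show ?thesis using dist_less_path[where f = f, OF 2 strict_triangle_f] len le by (simp add: dist_commute)
    qed
  qed
  show ?thesis using ordered[of i j] ordered[of j i] assms by (cases "i < j") (auto simp: dist_commute)
qed

text \<open>Each side contributes its direction once from either end, with opposite signs.\<close>

lemma sum_directions_zero:
  "(\<Sum>i<n. sgn (ps ! i - prev_vertex ps i) + sgn (ps ! i - next_vertex ps i)) = 0"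
proof -
  define g where "g k = sgn (f (Suc k) - f k)" for k
  have "(\<Sum>i<n. sgn (ps ! i - prev_vertex ps i) + sgn (ps ! i - next_vertex ps i))
      = (\<Sum>i<n. g (i + (n - 1)) - g i)"
  proof (rule sum.cong)
    fix i assume i: "i \<in> {..<n}"
    have "Suc (i + (n - 1)) = i + n" using n_ge_2 by simp
    then have "g (i + (n - 1)) = sgn (f i - f (i + n - 1))" using n_ge_2 by (simp add: g_def)
    moreover have "sgn (f i - f (Suc i)) = - g i" unfolding g_def by (metis minus_diff_eq sgn_minus)
    ultimately show "sgn (ps ! i - prev_vertex ps i) + sgn (ps ! i - next_vertex ps i) = g (i + (n - 1)) - g i"
      using prev_f[of i] next_f[of i] i by (simp add: f_nth)
  qed simp
  also have "\<dots> = (\<Sum>i<n. g (i + (n - 1))) - (\<Sum>i<n. g i)" by (simp add: sum_subtractf)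
  also have "(\<Sum>i<n. g (i + (n - 1))) = (\<Sum>k=(n-1)..<(n-1)+n. g k)"
    using sum.shift_bounds_nat_ivl[of g 0 "n - 1" n] by (simp add: atLeast0LessThan add.commute)
  also have "\<dots> = (\<Sum>i<n. g i)"
  proof (rule sum_periodic)
    show "g (k + n) = g k" for k using f_periodic[of "Suc k"] by (simp add: g_def)
  qed
  finally show ?thesis by simp
qed

end

section \<open>Trajectories with at least three vertices are long\<close>

lemma card_le_3E:
  assumes "finite T" "T \<noteq> {}" "card T \<le> 3"
  obtains a b c where "T = {a, b, c}"
proof -
  have "card T \<noteq> 0" using assms by simp
  then have "card T = 1 \<or> card T = 2 \<or> card T = 3" using assms(3) by linarith
  then show thesis
  proof (elim disjE)
    assume "card T = 1"
    then show thesis using that by (metis card_1_singletonE insert_absorb2)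
  next
    assume "card T = 2"
    then show thesis using that by (metis card_2_iff insert_absorb2)
  next
    assume "card T = 3"
    then show thesis using that by (metis card_3_iff)
  qed
qed

context parallel_disk_intersection
begin

text \<open>By Caratheodory's theorem the positive relation between the normals at the vertices can be reduced to
  at most three of them. Two opposite normals yield two vertices at distance at least \<open>w\<close>, and three
  normals yield an inscribed triangle of perimeter more than \<open>2 * w\<close>.\<close>

lemma long_trajectory:
  assumes K: "compact K" "\<And>u. norm u = 1 \<Longrightarrow> supp K u = h u"
    and traj: "generalized_billiard_trajectory K ps" and len: "length ps \<ge> 3"
  shows "2 * w < path_len ps"
proof -
  have cpp: "closed_polygonal_path ps" and fr: "set ps \<subseteq> frontier K"
    using traj by (auto simp: generalized_billiard_trajectory_def)
  interpret cyclic_path ps by unfold_locales (rule cpp)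
  have closedK: "closed K" using K(1) by (rule compact_imp_closed)
  have "\<exists>u \<mu>. norm u = 1 \<and> 0 < \<mu> \<and> (\<forall>x\<in>K. inner u x \<le> inner u (ps ! i)) \<and>
      sgn (ps ! i - prev_vertex ps i) + sgn (ps ! i - next_vertex ps i) = \<mu> *\<^sub>R u" if "i < n" for i
    using trajectory_normal[OF closedK traj, of i] that unfolding n_def by metis
  then obtain U \<mu> where U: "\<And>i. i < n \<Longrightarrow> norm (U i) = 1" "\<And>i. i < n \<Longrightarrow> 0 < \<mu> i"
    "\<And>i x. i < n \<Longrightarrow> x \<in> K \<Longrightarrow> inner (U i) x \<le> inner (U i) (ps ! i)"
    "\<And>i. i < n \<Longrightarrow> sgn (ps ! i - prev_vertex ps i) + sgn (ps ! i - next_vertex ps i) = \<mu> i *\<^sub>R U i"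
    by metis
  have hU: "inner (U i) (f i) = h (U i)" if "i < n" for i
  proof -
    have "ps ! i \<in> K" using fr closedK that by (metis frontier_subset_closed n_def nth_mem subsetD)
    then have "supp K (U i) = inner (U i) (ps ! i)" using U(3)[OF that] by (intro supp_eqI)
    then show ?thesis using K(2) U(1) that by (simp add: f_nth)
  qed
  have rel: "(\<Sum>i<n. \<mu> i *\<^sub>R U i) = 0"
  proof -
    have "(\<Sum>i<n. sgn (ps ! i - prev_vertex ps i) + sgn (ps ! i - next_vertex ps i)) = (\<Sum>i<n. \<mu> i *\<^sub>R U i)"
      by (intro sum.cong) (use U(4) in auto)
    then show ?thesis using sum_directions_zero by simp
  qed
  define M where "M = (\<Sum>i<n. \<mu> i)"
  have M: "0 < M" unfolding M_def using U(2) n_ge_2 by (intro sum_pos) (auto simp: lessThan_empty_iff)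
  have "(\<Sum>i<n. (\<mu> i / M) *\<^sub>R U i) \<in> convex hull (U ` {..<n})"
  proof (rule convex_sum)
    show "(\<Sum>i<n. \<mu> i / M) = 1" using M by (simp add: sum_divide_distrib[symmetric] M_def[symmetric])
    show "0 \<le> \<mu> i / M" if "i \<in> {..<n}" for i using U(2) M that by (simp add: less_imp_le)
    show "U i \<in> convex hull U ` {..<n}" if "i \<in> {..<n}" for i using that by (simp add: hull_inc)
  qed auto
  moreover have "(\<Sum>i<n. (\<mu> i / M) *\<^sub>R U i) = (1 / M) *\<^sub>R (\<Sum>i<n. \<mu> i *\<^sub>R U i)"
    by (simp add: scaleR_right.sum)
  ultimately have "0 \<in> convex hull (U ` {..<n})" using rel by simp
  then obtain T where T: "finite T" "T \<subseteq> U ` {..<n}" "card T \<le> 3" "0 \<in> convex hull T"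
    using caratheodory[of "U ` {..<n}"] by auto
  have "T \<noteq> {}" using T(4) by auto
  then obtain a b c where abc: "T = {a, b, c}" using card_le_3E T(1,3) by metis
  obtain \<alpha> \<beta> \<gamma> where co: "0 \<le> \<alpha>" "0 \<le> \<beta>" "0 \<le> \<gamma>" "\<alpha> + \<beta> + \<gamma> = 1" "\<alpha> *\<^sub>R a + \<beta> *\<^sub>R b + \<gamma> *\<^sub>R c = 0"
    using T(4) unfolding abc convex_hull_3 by auto
  obtain i j k where ijk: "i < n" "j < n" "k < n" "a = U i" "b = U j" "c = U k" using T(2) abc by auto
  have n3: "n \<ge> 3" using len by (simp add: n_def)
  have antipodal: "2 * w < path_len ps" if ij: "i < n" "j < n" "U i = - U j" for i j
  proof -
    have "w \<le> h (U i) + h (- U i)" by (rule h_width) (rule U(1)[OF ij(1)])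
    also have "\<dots> = inner (U i) (f i - f j)" using hU[OF ij(1)] hU[OF ij(2)] ij(3) by (simp add: inner_diff_right)
    also have "\<dots> \<le> dist (f i) (f j)" using U(1) ij by (intro inner_le_dist) simp
    finally have "w \<le> dist (f i) (f j)" .
    moreover have "i \<noteq> j"
    proof
      assume "i = j"
      then have "inner (U i) (U i) = - inner (U i) (U i)" using ij(3) by (metis inner_minus_left)
      then show False using U(1)[OF ij(1)] by (simp add: norm_eq_1)
    qed
    ultimately show ?thesis using path_len_gt_chord[OF n3 ij(1,2)] by simp
  qed
  note nrm = U(1)[OF ijk(1)] U(1)[OF ijk(2)] U(1)[OF ijk(3)]
  consider "U i = - U j" | "U j = - U k" | "U k = - U i"
    | "0 < cross2 (U j) (U k)" "0 < cross2 (U k) (U i)" "0 < cross2 (U i) (U j)"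
    | "cross2 (U j) (U k) < 0" "cross2 (U k) (U i) < 0" "cross2 (U i) (U j) < 0"
    using positive_relation_cases[OF nrm co(1-4)] co(5) unfolding ijk by blast
  then show ?thesis
  proof cases
    case 4
    have "2 * w < dist (f i) (f j) + dist (f j) (f k) + dist (f k) (f i)"
      by (rule triangle_perimeter_gt[OF nrm 4]) (use hU ijk in auto)
    then show ?thesis using path_len_ge_triangle[OF ijk(1-3)] by simp
  next
    case 5
    have "2 * w < dist (f i) (f k) + dist (f k) (f j) + dist (f j) (f i)"
      by (rule triangle_perimeter_gt[OF nrm(1,3,2)])
        (use hU ijk 5 cross2_skew[of "U j" "U k"] cross2_skew[of "U k" "U i"] cross2_skew[of "U i" "U j"] in auto)
    then show ?thesis using path_len_ge_triangle[OF ijk(1,3,2)] by simp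
  qed (use antipodal ijk in blast)+
qed

end

section \<open>Rounded disk-polygons\<close>

text \<open>A disk of radius \<open>\<epsilon>\<close> lies in a disk of radius \<open>r\<close> exactly if its center lies in the concentric disk of
  radius \<open>r - \<epsilon>\<close>.\<close>

lemma rounded_eq_sums:
  assumes "D = (\<Inter>c\<in>X. cball c r)" "0 < \<epsilon>"
  shows "rounded D \<epsilon> = {x + y |x y. x \<in> (\<Inter>c\<in>X. cball c (r - \<epsilon>)) \<and> y \<in> cball 0 \<epsilon>}"
proof -
  have sub: "cball x \<epsilon> \<subseteq> D \<longleftrightarrow> x \<in> (\<Inter>c\<in>X. cball c (r - \<epsilon>))" for x :: "real ^ 2"
    using assms by (auto simp: le_INF_iff cball_subset_cball_iff dist_commute)
  have "z \<in> cball x \<epsilon> \<longleftrightarrow> (\<exists>y. z = x + y \<and> y \<in> cball 0 \<epsilon>)" for x z :: "real ^ 2"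
    by (auto simp: dist_norm norm_minus_commute intro: exI[of _ "z - x"])
  then show ?thesis unfolding rounded_def sub by blast
qed

lemma inradius_set_bdd:
  fixes D :: "'a :: euclidean_space set"
  assumes "D \<subseteq> cball c r"
  shows "bdd_above {\<rho>. 0 \<le> \<rho> \<and> (\<exists>x. cball x \<rho> \<subseteq> D)}"
proof (rule bdd_aboveI)
  fix \<rho> assume "\<rho> \<in> {\<rho>. 0 \<le> \<rho> \<and> (\<exists>x. cball x \<rho> \<subseteq> D)}"
  then obtain x where "0 \<le> \<rho>" "cball x \<rho> \<subseteq> cball c r" using assms by blast
  then have "dist x c + \<rho> \<le> r" by (auto simp: cball_subset_cball_iff)
  then show "\<rho> \<le> r" using zero_le_dist[of x c] by linarith
qed

lemma inradius_pos:
  assumes "D \<subseteq> cball c r" "interior D \<noteq> {}"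
  shows "0 < inradius D"
proof -
  obtain x e where e: "0 < e" "cball x e \<subseteq> D"
    using assms(2) by (metis ex_in_conv mem_interior_cball)
  then have "e \<le> inradius D"
    unfolding inradius_def using inradius_set_bdd[OF assms(1)] by (intro cSup_upper) auto
  then show ?thesis using e by simp
qed

theorem theorem1p3:
  fixes r :: real and D :: "(real ^ 2) set"
  assumes "fat_disk_polygon r D"
  shows "\<exists>\<epsilon>\<^sub>0 > 0. \<epsilon>\<^sub>0 \<le> inradius D \<and>
           (\<forall>\<epsilon>. 0 < \<epsilon> \<and> \<epsilon> < \<epsilon>\<^sub>0 \<longrightarrow>
              (\<forall>ps. shortest_generalized_billiard_trajectory (rounded D \<epsilon>) ps \<longrightarrow>
                 periodic_trajectory 2 ps))"
proof -
  obtain X where X: "finite X" "X \<noteq> {}" "D = (\<Inter>c\<in>X. cball c r)" "interior D \<noteq> {}"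
    and fatX: "\<And>x y. x \<in> X \<Longrightarrow> y \<in> X \<Longrightarrow> dist x y \<le> r"
    using assms unfolding fat_disk_polygon_def disk_polygon_def by blast
  obtain c\<^sub>0 where "c\<^sub>0 \<in> X" using X(2) by blast
  then have Dc: "D \<subseteq> cball c\<^sub>0 r" unfolding X(3) by blast
  show ?thesis
  proof (intro exI[of _ "inradius D"] conjI allI impI)
    \<comment> \<open>The inradius itself serves as the bound: below it, the disks of radius \<open>r - \<epsilon>\<close> have a common interior point.\<close>
    show "0 < inradius D" using inradius_pos[OF Dc X(4)] .
    fix \<epsilon> ps assume \<epsilon>: "0 < \<epsilon> \<and> \<epsilon> < inradius D"
      and ps: "shortest_generalized_billiard_trajectory (rounded D \<epsilon>) ps"
    have "{\<rho>. 0 \<le> \<rho> \<and> (\<exists>x. cball x \<rho> \<subseteq> D)} \<noteq> {}"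
    proof -
      obtain x where "x \<in> D" using X(4) interior_subset by blast
      then have "0 \<in> {\<rho>. 0 \<le> \<rho> \<and> (\<exists>x. cball x \<rho> \<subseteq> D)}" by auto
      then show ?thesis by blast
    qed
    then obtain \<rho>' x\<^sub>0 where x0: "\<epsilon> < \<rho>'" "cball x\<^sub>0 \<rho>' \<subseteq> D"
      using less_cSup_iff[OF _ inradius_set_bdd[OF Dc], of \<epsilon>] \<epsilon> unfolding inradius_def by auto
    have slat: "dist c x\<^sub>0 < r - \<epsilon>" if "c \<in> X" for c
    proof -
      have "cball x\<^sub>0 \<rho>' \<subseteq> cball c r" using x0(2) that X(3) by blast
      then show ?thesis using x0(1) \<epsilon> by (auto simp: cball_subset_cball_iff dist_commute)
    qed
    define F where "F = (\<Inter>c\<in>X. cball c (r - \<epsilon>))"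
    define K where "K = rounded D \<epsilon>"
    have K: "K = {x + y |x y. x \<in> F \<and> y \<in> cball 0 \<epsilon>}"
      unfolding K_def F_def using rounded_eq_sums[OF X(3)] \<epsilon> by blast
    have x0E: "x\<^sub>0 \<in> F" using slat by (force simp: F_def)
    have "compact (cball c\<^sub>0 (r - \<epsilon>) \<inter> F)"
      unfolding F_def by (intro compact_Int_closed compact_cball closed_INT) auto
    moreover have "cball c\<^sub>0 (r - \<epsilon>) \<inter> F = F" using \<open>c\<^sub>0 \<in> X\<close> by (auto simp: F_def)
    ultimately have cE: "compact F" by simp
    have vE: "convex F" unfolding F_def by (intro convex_INT convex_cball)
    have cK: "compact K" unfolding K by (intro compact_sums cE compact_cball)
    have "K = (\<Union>x\<in>F. \<Union>y\<in>cball 0 \<epsilon>. {x + y})" unfolding K by blast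
    then have vK: "convex K" using convex_sums[OF vE convex_cball] by simp
    have "cball x\<^sub>0 \<epsilon> \<subseteq> K"
    proof
      fix z assume "z \<in> cball x\<^sub>0 \<epsilon>"
      then have "z - x\<^sub>0 \<in> cball 0 \<epsilon>" by (simp add: dist_norm norm_minus_commute)
      then show "z \<in> K" unfolding K using x0E by force
    qed
    then have iK: "interior K \<noteq> {}" using \<epsilon> by (metis empty_iff mem_interior_cball)
    have suppK: "supp K u = supp F u + \<epsilon>" if u: "norm u = 1" for u
    proof -
      obtain x where x: "x \<in> F" "supp F u = inner u x" using supp_attained[OF cE] x0E by blast
      have "supp K u = inner u (x + \<epsilon> *\<^sub>R u)"
      proof (rule supp_eqI)
        show "x + \<epsilon> *\<^sub>R u \<in> K" unfolding K using x u \<epsilon> by force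
        fix z assume "z \<in> K"
        then obtain y d where yd: "z = y + d" "y \<in> F" "norm d \<le> \<epsilon>" unfolding K by auto
        have "inner u y \<le> inner u x" using inner_le_supp[OF cE yd(2), of u] x by simp
        moreover have "inner u d \<le> \<epsilon>" using norm_cauchy_schwarz[of u d] u yd by simp
        ultimately show "inner u z \<le> inner u (x + \<epsilon> *\<^sub>R u)"
          using u yd by (simp add: inner_simps norm_eq_1)
      qed
      then show ?thesis using x u by (simp add: inner_simps norm_eq_1)
    qed
    obtain p q u w where pq: "p \<in> K" "q \<in> K" "norm u = 1" "0 < w" "p - q = w *\<^sub>R u"
      "\<And>x. x \<in> K \<Longrightarrow> inner u x \<le> inner u p" "\<And>x. x \<in> K \<Longrightarrow> inner u q \<le> inner u x"
      and wid: "\<And>v. norm v = 1 \<Longrightarrow> w \<le> supp K v + supp K (- v)"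
      by (rule double_normal[OF cK vK iK]) blast
    have "w = inner u p + inner (- u) q"
    proof -
      have "w = inner u (p - q)" using pq(3,5) by (simp add: norm_eq_1)
      then show ?thesis by (simp add: inner_diff_right)
    qed
    also have "inner u p = supp F u + \<epsilon>"
      using supp_eqI[of p K u] pq(1,6) suppK[OF pq(3)] by simp
    also have "inner (- u) q = supp F (- u) + \<epsilon>"
      using supp_eqI[of q K "- u"] pq(2,7) suppK[of "- u"] pq(3) by simp
    finally have "2 * \<epsilon> \<le> w"
      using inner_le_supp[OF cE x0E, of u] inner_le_supp[OF cE x0E, of "- u"] by simp
    moreover have "w \<le> supp F v + supp F (- v) + 2 * \<epsilon>" if "norm v = 1" for v
      using wid[OF that] suppK[OF that] suppK[of "- v"] that by simp
    ultimately interpret parallel_disk_intersection X "r - \<epsilon>" \<epsilon> w x\<^sub>0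
      using X(1,2) \<epsilon> slat fatX unfolding F_def by unfold_locales simp_all
    have EF: "E = F" by (simp add: E_def F_def)
    have "path_len ps \<le> 2 * w"
      using ps double_normal_is_trajectory[OF pq]
      unfolding shortest_generalized_billiard_trajectory_def K_def by metis
    moreover have "2 * w < path_len ps" if "3 \<le> length ps"
      using ps that long_trajectory[OF cK] suppK
      unfolding shortest_generalized_billiard_trajectory_def K_def h_def EF by blast
    moreover have "2 \<le> length ps"
      using ps by (auto simp: shortest_generalized_billiard_trajectory_def
          generalized_billiard_trajectory_def closed_polygonal_path_def)
    ultimately show "periodic_trajectory 2 ps" unfolding periodic_trajectory_def by linarith
  qed simp
qed

end
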